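(* Let $x_0\in\mathbb R^3$, $t_0\in\mathbb R$, $r>0$, $0<\rho\le\frac14$, $0<\ell\le\rho r$. Let $u\in L^\infty(I_r;L^2(\mathbb R^3;\mathbb R^3))$ satisfy $\operatorname{div}u=0$, and let $\chi\in C_c^\infty(Q_r)$ with $0\le\chi\le1$. With the quantities defined in the context, for every $\eta>0$, $$\mathcal A_{r,\ell}^{\mathrm{pair}}[\chi]\le\eta\,\mathcal P_{r,\ell}^{\rho}+\frac{C_\vartheta^2C_\varphi^2\rho^2}{\eta}\,M_{r,\rho}(u)\left(\frac r\ell\right)^5\mathcal O_{r,\ell}[\chi].$$ In particular $\mathcal A_{r,\ell}^{\mathrm{pair}}[\chi]<\infty$ whenever the right-hand side is finite.
   Context: Notation: $B_s=B_s(x_0)\subset\mathbb R^3$, $I_r=(t_0-r^2,t_0)$, $Q_r=B_r\times I_r$. Filter: $\varphi\in C_c^\infty(B_1(0))$, $\varphi\ge0$, $\int\varphi=1$, $\varphi_\ell(x)=\ell^{-3}\varphi(x/\ell)$. Set $U_\ell=\varphi_\ell*u$ (convolution in space), $\Omega_\ell=\operatorname{curl}U_\ell$, and $\xi_\ell=\Omega_\ell/|\Omega_\ell|$ where $\Omega_\ell\neq0$, $\xi_\ell=0$ where $\Omega_\ell=0$. $C_\varphi>0$ is a fixed constant such that $\|\operatorname{curl}(\varphi_\ell*f)\|_{L^\infty(\mathbb R^3)}\le C_\varphi\ell^{-5/2}\|f\|_{L^2(\mathbb R^3)}$ for every $\ell>0$ and every $f\in L^2(\mathbb R^3;\mathbb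 R^3)$. Kernel cutoff: $\vartheta\in C_c^\infty(B_1(0))$ is radial, $0\le\vartheta\le1$, $\vartheta\equiv1$ on $B_{1/2}(0)$; $C_\vartheta=\int_{B_1(0)}\vartheta(w)|w|^{-2}\,dw$. Local energy: $M_{r,\rho}(u)=\frac1r\,\mathrm{ess\,sup}_{t\in I_r}\int_{B_{(1+2\rho)r}}|u(x,t)|^2\,dx$. Filtered enstrophy and enlarged filtered diffusion: $$\mathcal O_{r,\ell}[\chi]=\frac1r\iint_{Q_r}\chi|\Omega_\ell|^2\,dx\,dt,\qquad \mathcal P_{r,\ell}^{\rho}=r\int_{I_r}\int_{B_{(1+\rho)r}}|\nabla\Omega_\ell|^2\,dx\,dt .$$ Pairwise direction defect (inner integral interpreted by monotone truncation at $|z|=\delta$, $\delta\downarrow0$; values in $[0,\infty]$): $$\mathcal A_{r,\ell}^{\mathrm{pair}}[\chi]=r\iint_{Q_r}\chi(x,t)|\Omega_\ell(x,t)|^2\int_{\mathbb R^3}\vartheta\!\left(\frac z{\rho r}\right)\frac{|\xi_\ell(x,t)-\xi_\ell(x-z,t)|\,|\Omega_\ell(x-z,t)|}{|z|^3}\,dz\,dx\,dt .$$ *)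

theory Defs
  imports "HOL-Analysis.Analysis" "HOL-Probability.Essential_Supremum"
begin

type_synonym R3 = "real^3"

section \<open>Smooth functions and differential operators\<close>

primrec Ck :: "nat \<Rightarrow> ('a::real_normed_vector \<Rightarrow> 'b::real_normed_vector) \<Rightarrow> bool" where
  "Ck 0 f \<longleftrightarrow> continuous_on UNIV f"
| "Ck (Suc k) f \<longleftrightarrow> (\<forall>x. f differentiable (at x)) \<and>
     (\<forall>v. Ck k (\<lambda>x. frechet_derivative f (at x) v))"

text \<open>Elements of $C_c^\infty(S)$, $S$ open, are regarded as functions on the whole space,
  extended by zero.\<close>

definition Cc_infty :: "'a::real_normed_vector set \<Rightarrow> ('a \<Rightarrow> real) \<Rightarrow> bool" where
  "Cc_infty S f \<longleftrightarrow> (\<forall>k. Ck k f) \<and>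
     compact (closure {x. f x \<noteq> 0}) \<and> closure {x. f x \<noteq> 0} \<subseteq> S"

definition pd :: "3 \<Rightarrow> (R3 \<Rightarrow> 'b::real_normed_vector) \<Rightarrow> R3 \<Rightarrow> 'b" where
  "pd j F x = frechet_derivative F (at x) (axis j 1)"

definition curl :: "(R3 \<Rightarrow> R3) \<Rightarrow> R3 \<Rightarrow> R3" where
  "curl F x = vector [pd 2 F x $ 3 - pd 3 F x $ 2,
                      pd 3 F x $ 1 - pd 1 F x $ 3,
                      pd 1 F x $ 2 - pd 2 F x $ 1]"

text \<open>The square of the Frobenius norm of the Jacobian matrix.\<close>

definition grad_norm_sq :: "(R3 \<Rightarrow> R3) \<Rightarrow> R3 \<Rightarrow> real" where
  "grad_norm_sq F x = (\<Sum>i\<in>UNIV. \<Sum>j\<in>UNIV. (pd j F x $ i)\<^sup>2)"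

section \<open>Function spaces\<close>

definition in_L2 :: "(R3 \<Rightarrow> R3) \<Rightarrow> bool" where
  "in_L2 f \<longleftrightarrow> f \<in> borel_measurable lebesgue \<and> integrable lebesgue (\<lambda>x. (norm (f x))\<^sup>2)"

definition L2norm :: "(R3 \<Rightarrow> R3) \<Rightarrow> real" where
  "L2norm f = sqrt (LINT x|lebesgue. (norm (f x))\<^sup>2)"

definition Linfnorm :: "(R3 \<Rightarrow> R3) \<Rightarrow> ennreal" where
  "Linfnorm f = esssup lebesgue (\<lambda>x. ennreal (norm (f x)))"

text \<open>$L^\infty(I;L^2(\mathbb R^3;\mathbb R^3))$: since $L^2$ is separable, every strongly
  measurable $L^2$-valued class has a jointly Lebesgue measurable representative, and conversely
  such representatives give strongly measurable classes. Values at times outside $I$ play no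
  role.\<close>

definition in_Linf_L2 :: "real set \<Rightarrow> (R3 \<times> real \<Rightarrow> R3) \<Rightarrow> bool" where
  "in_Linf_L2 I u \<longleftrightarrow> u \<in> borel_measurable (lebesgue_on (UNIV \<times> I)) \<and>
     (\<exists>C. AE t in lebesgue_on I. in_L2 (\<lambda>x. u (x, t)) \<and> L2norm (\<lambda>x. u (x, t)) \<le> C)"

text \<open>$\operatorname{div} u(\cdot,t)=0$ in the sense of distributions on $\mathbb R^3$, for almost
  every time $t$.\<close>

definition div_free :: "real set \<Rightarrow> (R3 \<times> real \<Rightarrow> R3) \<Rightarrow> bool" where
  "div_free I u \<longleftrightarrow> (AE t in lebesgue_on I. \<forall>\<psi>. Cc_infty UNIV \<psi> \<longrightarrow>
     (LINT x|lebesgue. (\<Sum>j\<in>UNIV. u (x, t) $ j * pd j \<psi> x)) = 0)"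

section \<open>Parabolic cylinders and filtered fields\<close>

definition Itime :: "real \<Rightarrow> real \<Rightarrow> real set" where
  "Itime t0 r = {t0 - r\<^sup>2 <..< t0}"

definition Qcyl :: "R3 \<Rightarrow> real \<Rightarrow> real \<Rightarrow> (R3 \<times> real) set" where
  "Qcyl x0 t0 r = ball x0 r \<times> Itime t0 r"

definition filter_conv :: "(R3 \<Rightarrow> real) \<Rightarrow> real \<Rightarrow> (R3 \<Rightarrow> R3) \<Rightarrow> R3 \<Rightarrow> R3" where
  "filter_conv \<phi> l f x = (LINT y|lebesgue. (\<phi> ((x - y) /\<^sub>R l) / l ^ 3) *\<^sub>R f y)"

definition Omega :: "(R3 \<Rightarrow> real) \<Rightarrow> real \<Rightarrow> (R3 \<times> real \<Rightarrow> R3) \<Rightarrow> R3 \<Rightarrow> real \<Rightarrow> R3" where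
  "Omega \<phi> l u x t = curl (filter_conv \<phi> l (\<lambda>y. u (y, t))) x"

definition xi :: "(R3 \<Rightarrow> real) \<Rightarrow> real \<Rightarrow> (R3 \<times> real \<Rightarrow> R3) \<Rightarrow> R3 \<Rightarrow> real \<Rightarrow> R3" where
  "xi \<phi> l u x t = (if Omega \<phi> l u x t = 0 then 0
                   else Omega \<phi> l u x t /\<^sub>R norm (Omega \<phi> l u x t))"

section \<open>The functionals\<close>

text \<open>All are integrals of nonnegative functions and take values in $[0,\infty]$.\<close>

definition C_theta :: "(R3 \<Rightarrow> real) \<Rightarrow> ennreal" where
  "C_theta \<theta> = (\<integral>\<^sup>+w\<in>ball 0 1. ennreal (\<theta> w / (norm w)\<^sup>2) \<partial>lebesgue)"

definition local_energy ::
  "R3 \<Rightarrow> real \<Rightarrow> real \<Rightarrow> real \<Rightarrow> (R3 \<times> real \<Rightarrow> R3) \<Rightarrow> ennreal" where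
  "local_energy x0 t0 r \<rho> u = ennreal (1 / r) *
     esssup (lebesgue_on (Itime t0 r))
       (\<lambda>t. \<integral>\<^sup>+x\<in>ball x0 ((1 + 2 * \<rho>) * r). ennreal ((norm (u (x, t)))\<^sup>2) \<partial>lebesgue)"

definition enstrophy ::
  "(R3 \<Rightarrow> real) \<Rightarrow> R3 \<Rightarrow> real \<Rightarrow> real \<Rightarrow> real \<Rightarrow> (R3 \<times> real \<Rightarrow> R3)
    \<Rightarrow> (R3 \<times> real \<Rightarrow> real) \<Rightarrow> ennreal" where
  "enstrophy \<phi> x0 t0 r l u chi = ennreal (1 / r) *
     (\<integral>\<^sup>+p\<in>Qcyl x0 t0 r. ennreal (chi p * (norm (Omega \<phi> l u (fst p) (snd p)))\<^sup>2) \<partial>lebesgue)"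

definition diffusion ::
  "(R3 \<Rightarrow> real) \<Rightarrow> R3 \<Rightarrow> real \<Rightarrow> real \<Rightarrow> real \<Rightarrow> real \<Rightarrow> (R3 \<times> real \<Rightarrow> R3) \<Rightarrow> ennreal" where
  "diffusion \<phi> x0 t0 r \<rho> l u = ennreal r *
     (\<integral>\<^sup>+t\<in>Itime t0 r. (\<integral>\<^sup>+x\<in>ball x0 ((1 + \<rho>) * r).
        ennreal (grad_norm_sq (\<lambda>y. Omega \<phi> l u y t) x) \<partial>lebesgue) \<partial>lebesgue)"

text \<open>The truncated integrals increase as \<open>\<delta>\<close> decreases to 0, so the supremum is their limit.\<close>

definition pair_inner ::
  "(R3 \<Rightarrow> real) \<Rightarrow> (R3 \<Rightarrow> real) \<Rightarrow> real \<Rightarrow> real \<Rightarrow> real \<Rightarrow> (R3 \<times> real \<Rightarrow> R3)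
    \<Rightarrow> R3 \<Rightarrow> real \<Rightarrow> ennreal" where
  "pair_inner \<phi> \<theta> r \<rho> l u x t =
     (SUP \<delta>\<in>{0<..}. \<integral>\<^sup>+z\<in>{z. \<delta> < norm z}.
        ennreal (\<theta> (z /\<^sub>R (\<rho> * r)) *
          (norm (xi \<phi> l u x t - xi \<phi> l u (x - z) t) * norm (Omega \<phi> l u (x - z) t)
            / norm z ^ 3)) \<partial>lebesgue)"

definition pair_defect ::
  "(R3 \<Rightarrow> real) \<Rightarrow> (R3 \<Rightarrow> real) \<Rightarrow> R3 \<Rightarrow> real \<Rightarrow> real \<Rightarrow> real \<Rightarrow> real
    \<Rightarrow> (R3 \<times> real \<Rightarrow> R3) \<Rightarrow> (R3 \<times> real \<Rightarrow> real) \<Rightarrow> ennreal" where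
  "pair_defect \<phi> \<theta> x0 t0 r \<rho> l u chi = ennreal r *
     (\<integral>\<^sup>+p\<in>Qcyl x0 t0 r. ennreal (chi p * (norm (Omega \<phi> l u (fst p) (snd p)))\<^sup>2)
        * pair_inner \<phi> \<theta> r \<rho> l u (fst p) (snd p) \<partial>lebesgue)"

end

theory Submission
  imports Defs
begin

text \<open>Since \<open>norm (sgn a - sgn b) * norm b \<le> 2 * norm (a - b)\<close> for \<open>a \<noteq> 0\<close>, the direction defect is
  controlled by difference quotients of the filtered vorticity, weighted by the kernel
  \<open>k z = \<theta> (z / (\<rho> r)) / (norm z)\<^sup>2\<close> of total mass \<open>W = \<rho> * r * C_theta \<theta>\<close>. With
  \<open>c = chi * (norm \<Omega>)\<^sup>2\<close>, Young's inequality under the kernel splits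
  \<open>2 * c * (norm (\<Omega> x - \<Omega> (x - z)) / norm z)\<close> into \<open>\<eta> / W\<close> times the squared quotient, whose integral over
  the ball is at most the diffusion on the enlarged ball, and \<open>W / \<eta> * c\<^sup>2\<close>, which the local supremum bound on
  \<open>\<Omega>\<close> in terms of the local energy reduces to the enstrophy.\<close>


section \<open>Convolution with smooth compactly supported kernels\<close>

text \<open>The kernel \<open>1 / norm z ^ 3\<close> is not integrable at the origin, so the
  difference of directions has to supply a factor \<open>norm z\<close>: one power goes into the
  difference quotient, and the weight that remains has mass proportional to its radius
  \<open>\<rho> * r\<close>. The Young parameter is \<open>\<eta> / W\<close> because Tonelli
  returns exactly the factor \<open>W\<close> in front of the gradient integral. The other term then
  carries \<open>W^2 / \<eta>\<close>, which is where \<open>C_theta^2\<close>,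
  \<open>\<rho>^2\<close> and two of the five powers of \<open>r\<close> come from; the other three
  are normalising factors of the functionals. Measurability shapes the rest. The field is only
  jointly Lebesgue measurable and square integrable at almost every time, while Tonelli wants Borel
  integrands and the gradient estimate wants smooth slices. Hence \<open>u\<close> is exchanged for
  a Borel field whose slices are in L2 at every time. The pair functional is bounded pointwise
  before any integrals are exchanged, so Tonelli acts only on the Borel majorant.\<close>

lemma frechet_derivative_scale:
  fixes f :: "'a::real_normed_vector \<Rightarrow> real"
  assumes "\<forall>x. f differentiable (at x)"
  shows "((\<lambda>x. c * f (a *\<^sub>R x)) has_derivative (\<lambda>v. (c * a) * frechet_derivative f (at (a *\<^sub>R x)) v)) (at x)"
proof -
  have D: "(f has_derivative frechet_derivative f (at (a *\<^sub>R x))) (at (a *\<^sub>R x))"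
    using assms frechet_derivative_works by blast
  have "((\<lambda>x. f (a *\<^sub>R x)) has_derivative (\<lambda>v. frechet_derivative f (at (a *\<^sub>R x)) (a *\<^sub>R v))) (at x)"
    by (rule has_derivative_compose[of "\<lambda>x. a *\<^sub>R x" "\<lambda>v. a *\<^sub>R v" x UNIV f, OF _ D]) (auto intro!: derivative_eq_intros)
  moreover have "linear (frechet_derivative f (at (a *\<^sub>R x)))"
    using D has_derivative_linear by blast
  ultimately show ?thesis
    by (auto intro!: derivative_eq_intros simp: linear_cmul algebra_simps)
qed

lemma Ck_scale:
  fixes f :: "'a::real_normed_vector \<Rightarrow> real"
  assumes "Ck k f" shows "Ck k (\<lambda>x. c * f (a *\<^sub>R x))"
  using assms
\<comment> \<open>The constant has to vary: each differentiation multiplies it by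
  \<open>a\<close>.\<close>
proof (induction k arbitrary: f c)
  case 0
  then show ?case by (auto intro!: continuous_intros continuous_on_compose2[of UNIV f])
next
  case (Suc k)
  then have d: "\<forall>x. f differentiable (at x)" and v: "\<And>v. Ck k (\<lambda>x. frechet_derivative f (at x) v)" by auto
  note D = frechet_derivative_scale[OF d, of c a]
  have "frechet_derivative (\<lambda>x. c * f (a *\<^sub>R x)) (at x) v = (c * a) * frechet_derivative f (at (a *\<^sub>R x)) v" for x v
    using frechet_derivative_at[OF D[of x]] by metis
  with Suc.IH[OF v] D show ?case by (auto simp: differentiable_def)
qed

lemma Ck_mono: "Ck (Suc k) f \<Longrightarrow> Ck k f"
proof (induction k arbitrary: f)
  case 0
  then show ?case by (auto intro!: continuous_at_imp_continuous_on differentiable_imp_continuous_within)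
qed auto

text \<open>The strict inequality makes the exterior region open, so the property passes to
  directional derivatives with the same \<open>R\<close>. No sign is imposed on \<open>R\<close>,
  which is why \<open>\<bar>R\<bar>\<close> appears in the radii below.\<close>

definition vanishes_outside :: "real \<Rightarrow> ('a::real_normed_vector \<Rightarrow> 'b::real_normed_vector) \<Rightarrow> bool" where
  "vanishes_outside R g \<longleftrightarrow> (\<forall>x. R < norm x \<longrightarrow> g x = 0)"

lemma frechet_derivative_vanishes_outside:
  assumes "vanishes_outside R g"
  shows "vanishes_outside R (\<lambda>x. frechet_derivative g (at x) v)"
  unfolding vanishes_outside_def
proof (intro allI impI)
  fix x :: 'a assume x: "R < norm x"
  have "open {x::'a. R < norm x}" by (intro open_Collect_less continuous_intros)
  then have "(g has_derivative (\<lambda>_. 0)) (at x)"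
    using assms x unfolding vanishes_outside_def
    by (intro has_derivative_transform_within_open[OF has_derivative_const[of 0], where s = "{x. R < norm x}"]) auto
  from frechet_derivative_at[OF this] show "frechet_derivative g (at x) v = 0"
    by (simp add: fun_eq_iff)
qed

lemma vanishing_uniformly_continuous:
  fixes g :: "'a::euclidean_space \<Rightarrow> real"
  assumes "continuous_on UNIV g" "vanishes_outside R g"
  shows "uniformly_continuous_on UNIV g"
  unfolding uniformly_continuous_on_def
proof (intro allI impI)
  fix e :: real assume e: "0 < e"
  \<comment> \<open>The margin 2 is for pairs at distance below 1: either both points lie in this
    ball, or both lie where \<open>g\<close> vanishes.\<close>
  have "uniformly_continuous_on (cball 0 (\<bar>R\<bar> + 2)) g"
    using assms(1) by (intro compact_uniformly_continuous) (auto intro: continuous_on_subset)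
  then obtain d where d: "0 < d" "\<And>x y. x \<in> cball 0 (\<bar>R\<bar>+2) \<Longrightarrow> y \<in> cball 0 (\<bar>R\<bar>+2) \<Longrightarrow> dist y x < d \<Longrightarrow> dist (g y) (g x) < e"
    using e unfolding uniformly_continuous_on_def by metis
  have "dist (g y) (g x) < e" if xy: "dist y x < min d 1" for x y
  proof (cases "norm x \<le> \<bar>R\<bar> + 1")
    case True
    have "norm y \<le> norm x + dist y x" by (metis add.commute dist_0_norm dist_commute dist_triangle)
    then show ?thesis using True xy d(2)[of x y] by auto
  next
    case False
    have "norm x \<le> norm y + dist y x" by (metis dist_0_norm dist_triangle)
    then have "g x = 0" "g y = 0" using False xy assms(2) unfolding vanishes_outside_def by auto
    then show ?thesis using e by simp
  qed
  then show "\<exists>d>0. \<forall>x\<in>UNIV. \<forall>x'\<in>UNIV. dist x' x < d \<longrightarrow> dist (g x') (g x) < e"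
    using d(1) by (intro exI[of _ "min d 1"]) auto
qed

lemma vanishing_bounded:
  fixes g :: "'a::euclidean_space \<Rightarrow> real"
  assumes "continuous_on UNIV g" "vanishes_outside R g"
  obtains B where "0 < B" "\<And>x. \<bar>g x\<bar> \<le> B"
proof -
  have "compact (g ` cball 0 \<bar>R\<bar>)"
    using assms(1) by (intro compact_continuous_image) (auto intro: continuous_on_subset)
  then obtain B where B: "0 < B" "\<And>y. y \<in> g ` cball 0 \<bar>R\<bar> \<Longrightarrow> norm y \<le> B"
    using compact_imp_bounded bounded_pos by metis
  have "\<bar>g x\<bar> \<le> B" for x
  proof (cases "norm x \<le> \<bar>R\<bar>")
    case True then show ?thesis using B(2)[of "g x"] by auto
  next
    case False then show ?thesis using B(1) assms(2) unfolding vanishes_outside_def by auto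
  qed
  with B(1) that show thesis by blast
qed

text \<open>Compact support makes the first-order Taylor remainder small uniformly in the base point.\<close>

lemma uniform_taylor:
  fixes g :: "'a::euclidean_space \<Rightarrow> real"
  assumes C: "Ck 1 g" and V: "vanishes_outside R g" and e: "0 < e"
  obtains d where "0 < d" "\<And>p h. norm h < d \<Longrightarrow> \<bar>g (p + h) - g p - frechet_derivative g (at p) h\<bar> \<le> e * norm h"
proof -
  let ?D = "\<lambda>x. frechet_derivative g (at x)"
  have diff: "(g has_derivative ?D x) (at x)" for x
    using C frechet_derivative_works by auto
  then have lin: "linear (?D x)" for x using has_derivative_linear by blast
  \<comment> \<open>\<open>Ck\<close> gives continuity of the derivative one direction at a time, so
    the increment is estimated along each basis vector and the error is shared among them.\<close>
  define e' where "e' = e / DIM('a)"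
  have e': "0 < e'" using e unfolding e'_def by simp
  have "uniformly_continuous_on UNIV (\<lambda>x. ?D x b)" for b
    using C by (intro vanishing_uniformly_continuous[OF _ frechet_derivative_vanishes_outside[OF V]]) auto
  then have "\<forall>b. \<exists>d>0. \<forall>x y. dist y x < d \<longrightarrow> dist (?D y b) (?D x b) < e'"
    using e' unfolding uniformly_continuous_on_def by auto
  then obtain d where d: "\<And>b. 0 < d b" "\<And>b x y. dist y x < d b \<Longrightarrow> dist (?D y b) (?D x b) < e'" by metis
  define d0 where "d0 = Min (d ` Basis)"
  have d0: "0 < d0" "\<And>b. b \<in> Basis \<Longrightarrow> d0 \<le> d b" unfolding d0_def using d(1) by auto
  have "\<bar>g (p + h) - g p - ?D p h\<bar> \<le> e * norm h" if h: "norm h < d0" for p h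
  proof -
    \<comment> \<open>With the linear part subtracted, the mean value theorem expresses the whole
      remainder as a difference of derivatives at two points of the segment.\<close>
    have der: "((\<lambda>s. g (p + s *\<^sub>R h) - s * ?D p h) has_derivative (\<lambda>s'. ?D (p + s *\<^sub>R h) (s' *\<^sub>R h) - s' * ?D p h)) (at s)" for s :: real
    proof -
      have "((\<lambda>s. g (p + s *\<^sub>R h)) has_derivative (\<lambda>s'. ?D (p + s *\<^sub>R h) (s' *\<^sub>R h))) (at s)"
        by (rule has_derivative_compose[OF _ diff]) (auto intro!: derivative_eq_intros)
      then show ?thesis by (auto intro!: derivative_eq_intros)
    qed
    have "\<exists>s\<in>{0<..<1}. (\<lambda>s. g (p + s *\<^sub>R h) - s * ?D p h) 1 - (\<lambda>s. g (p + s *\<^sub>R h) - s * ?D p h) 0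
        = (\<lambda>s'. ?D (p + s *\<^sub>R h) (s' *\<^sub>R h) - s' * ?D p h) (1 - 0)"
      by (rule mvt_simple) (auto intro!: has_derivative_at_withinI der)
    then obtain s where s: "0 < s" "s < 1" "g (p + h) - g p - ?D p h = ?D (p + s *\<^sub>R h) h - ?D p h"
      by (auto simp: algebra_simps)
    have rep: "?D q h = (\<Sum>b\<in>Basis. (h \<bullet> b) * ?D q b)" for q
      by (subst euclidean_representation[of h, symmetric])
        (simp add: linear_sum[OF lin] linear_cmul[OF lin])
    have "\<bar>?D (p + s *\<^sub>R h) h - ?D p h\<bar> = \<bar>\<Sum>b\<in>Basis. (h \<bullet> b) * (?D (p + s *\<^sub>R h) b - ?D p b)\<bar>"
      unfolding rep[of "p + s *\<^sub>R h"] rep[of p] by (simp add: sum_subtractf algebra_simps)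
    also have "\<dots> \<le> (\<Sum>b\<in>Basis. \<bar>(h \<bullet> b) * (?D (p + s *\<^sub>R h) b - ?D p b)\<bar>)" by (rule sum_abs)
    also have "\<dots> \<le> (\<Sum>b\<in>(Basis::'a set). norm h * e')"
    proof (rule sum_mono)
      fix b :: 'a assume b: "b \<in> Basis"
      have "s * norm h \<le> 1 * norm h" using s by (intro mult_right_mono) auto
      then have "dist (p + s *\<^sub>R h) p < d b" using h s d0(2)[OF b] by (simp add: dist_norm)
      then have "\<bar>?D (p + s *\<^sub>R h) b - ?D p b\<bar> \<le> e'" using d(2) by (force simp: dist_real_def)
      then show "\<bar>(h \<bullet> b) * (?D (p + s *\<^sub>R h) b - ?D p b)\<bar> \<le> norm h * e'"
        unfolding abs_mult using b Basis_le_norm by (intro mult_mono) auto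
    qed
    also have "\<dots> = e * norm h" by (simp add: e'_def)
    finally show ?thesis using s by simp
  qed
  with d0(1) that show thesis by blast
qed

section \<open>Local integrability and differentiation of convolutions\<close>

definition locally_integrable :: "('a::euclidean_space \<Rightarrow> 'b::euclidean_space) \<Rightarrow> bool" where
  "locally_integrable f \<longleftrightarrow> (\<forall>R. set_integrable lebesgue (ball 0 R) f)"

lemma locally_integrable_ball:
  assumes "locally_integrable f" shows "set_integrable lebesgue (ball x R) f"
proof (rule set_integrable_subset)
  show "set_integrable lebesgue (ball 0 (norm x + R)) f" using assms by (simp add: locally_integrable_def)
  show "ball x R \<subseteq> ball 0 (norm x + R)"
    by (metis ball_subset_ball_iff dist_0_norm dist_commute order_refl add.commute)
qed auto

text \<open>A ball has finite measure and \<open>norm (f x)\<close> is at most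
  \<open>1 + (norm (f x))^2\<close>, so the sum of the indicator and the square dominates.\<close>

lemma in_L2_locally_integrable:
  assumes "in_L2 f" shows "locally_integrable f"
  unfolding locally_integrable_def set_integrable_def
proof
  fix R
  have [measurable]: "f \<in> borel_measurable lebesgue" and i: "integrable lebesgue (\<lambda>x. (norm (f x))\<^sup>2)"
    using assms by (auto simp: in_L2_def)
  have m: "ball 0 R \<in> lmeasurable" by (simp add: lmeasurable_ball)
  show "integrable lebesgue (\<lambda>x. indicat_real (ball 0 R) x *\<^sub>R f x)"
  proof (rule Bochner_Integration.integrable_bound)
    show "integrable lebesgue (\<lambda>x. indicat_real (ball 0 R) x + (norm (f x))\<^sup>2)"
      using m i by (intro Bochner_Integration.integrable_add) (auto simp: fmeasurable_def)
    have "norm (f x) \<le> 1 + (norm (f x))\<^sup>2" for x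
      using power2_ge_1_iff[of "norm (f x)"] zero_le_power2[of "norm (f x) - 1"] by (simp add: power2_eq_square algebra_simps) (smt (verit) norm_ge_zero zero_le_mult_iff)
    then show "AE x in lebesgue. norm (indicat_real (ball 0 R) x *\<^sub>R f x) \<le> norm (indicat_real (ball 0 R) x + (norm (f x))\<^sup>2)"
      by (intro AE_I2) (auto simp: indicator_def)
    show "(\<lambda>x. indicat_real (ball 0 R) x *\<^sub>R f x) \<in> borel_measurable lebesgue"
      by (intro borel_measurable_scaleR borel_measurable_indicator) auto
  qed
qed

definition conv :: "('a \<Rightarrow> real) \<Rightarrow> ('a \<Rightarrow> 'b) \<Rightarrow> 'a::euclidean_space \<Rightarrow> 'b::euclidean_space" where
  "conv g f x = (LINT y|lebesgue. g (x - y) *\<^sub>R f y)"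

text \<open>The reflected kernel is supported near \<open>x\<close>, so \<open>f\<close> may be cut
  off to a ball, where it is integrable, and multiplied by a bounded function.\<close>

lemma conv_integrable:
  assumes f: "locally_integrable f" and g: "continuous_on UNIV g" "vanishes_outside R g"
  shows "integrable lebesgue (\<lambda>y. g (x - y) *\<^sub>R f y)"
proof -
  obtain B where B: "0 < B" "\<And>x. \<bar>g x\<bar> \<le> B" using vanishing_bounded[OF g] by blast
  let ?S = "ball x (\<bar>R\<bar> + 1)"
  have i: "integrable lebesgue (\<lambda>y. indicat_real ?S y *\<^sub>R f y)"
    using locally_integrable_ball[OF f, of x "\<bar>R\<bar>+1"] by (simp add: set_integrable_def)
  have gm: "(\<lambda>y. g (x - y)) \<in> borel_measurable lebesgue"
    unfolding measurable_lborel1[symmetric]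
    by (intro measurable_completion) (auto intro!: borel_measurable_continuous_onI continuous_on_compose2[OF g(1)] continuous_intros)
  have eq: "g (x - y) *\<^sub>R f y = g (x - y) *\<^sub>R (indicat_real ?S y *\<^sub>R f y)" for y
  proof (cases "g (x - y) = 0")
    case False
    then have "norm (x - y) \<le> R" using g(2) unfolding vanishes_outside_def by (meson not_le)
    then have "y \<in> ?S" by (simp add: dist_norm)
    then show ?thesis by simp
  qed simp
  show ?thesis unfolding eq
  proof (rule Bochner_Integration.integrable_bound)
    show "integrable lebesgue (\<lambda>y. B *\<^sub>R norm (indicat_real ?S y *\<^sub>R f y))"
      using i by (intro integrable_scaleR_right integrable_norm)
    show "(\<lambda>y. g (x - y) *\<^sub>R (indicat_real ?S y *\<^sub>R f y)) \<in> borel_measurable lebesgue"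
      using gm borel_measurable_integrable[OF i] by (rule borel_measurable_scaleR)
    show "AE y in lebesgue. norm (g (x - y) *\<^sub>R (indicat_real ?S y *\<^sub>R f y)) \<le> norm (B *\<^sub>R norm (indicat_real ?S y *\<^sub>R f y))"
      using B by (intro AE_I2) (auto simp: abs_mult mult.assoc intro!: mult_right_mono)
  qed
qed

text \<open>The uniform Taylor bound is integrated directly against \<open>f\<close>: the remainder
  is small relative to \<open>norm h\<close> uniformly in the integration variable and lives in a
  fixed ball, so its integral is controlled by the L1 norm of \<open>f\<close> there. No limit is
  taken under the integral.\<close>

lemma conv_has_derivative:
  fixes f :: "'a::euclidean_space \<Rightarrow> 'b::euclidean_space"
  assumes f: "locally_integrable f" and C: "Ck 1 g" and V: "vanishes_outside R g"
  shows "(conv g f has_derivative (\<lambda>h. conv (\<lambda>p. frechet_derivative g (at p) h) f x)) (at x)"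
proof -
  let ?D = "\<lambda>x. frechet_derivative g (at x)"
  have "(g has_derivative ?D x) (at x)" for x
    using C frechet_derivative_works by auto
  then have lin: "linear (?D x)" for x using has_derivative_linear by blast
  have Dc: "continuous_on UNIV (\<lambda>x. ?D x h)" for h using C by auto
  have gc: "continuous_on UNIV g" using Ck_mono[of 0 g] C by simp
  note DV = frechet_derivative_vanishes_outside[OF V]
  note ig = conv_integrable[OF f gc V] and iD = conv_integrable[OF f Dc DV]
  have linI: "linear (\<lambda>h. conv (\<lambda>p. ?D p h) f x)"
  proof (rule linearI)
    show "conv (\<lambda>p. ?D p (h + k)) f x = conv (\<lambda>p. ?D p h) f x + conv (\<lambda>p. ?D p k) f x" for h k
      unfolding conv_def linear_add[OF lin] scaleR_left_distrib
      by (rule Bochner_Integration.integral_add[OF iD iD])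
    show "conv (\<lambda>p. ?D p (c *\<^sub>R h)) f x = c *\<^sub>R conv (\<lambda>p. ?D p h) f x" for c h
      unfolding conv_def linear_cmul[OF lin] real_scaleR_def scaleR_scaleR[symmetric]
      by (rule integral_scaleR_right)
  qed
  \<comment> \<open>For \<open>y\<close> within distance 1 of \<open>x\<close> and \<open>w\<close>
    outside this ball, both \<open>x - w\<close> and \<open>y - w\<close> lie where the kernel
    vanishes.\<close>
  let ?S = "ball x (\<bar>R\<bar> + 2)"
  have i: "integrable lebesgue (\<lambda>y. indicat_real ?S y *\<^sub>R f y)"
    using locally_integrable_ball[OF f, of x "\<bar>R\<bar>+2"] by (simp add: set_integrable_def)
  \<comment> \<open>\<open>K - 1\<close> is the L1 norm of \<open>f\<close> on the ball; the added 1
    keeps the division by \<open>K\<close> legitimate when that norm is zero.\<close>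
  define K where "K = (LINT y|lebesgue. norm (indicat_real ?S y *\<^sub>R f y)) + 1"
  have K: "K > 0" unfolding K_def by (smt (verit) integral_nonneg_AE AE_I2 norm_ge_zero)
  show ?thesis unfolding has_derivative_at_alt
  proof (intro conjI allI impI)
    show "bounded_linear (\<lambda>h. conv (\<lambda>p. ?D p h) f x)" using linI linear_conv_bounded_linear by blast
    fix e :: real assume e: "0 < e"
    obtain d where d: "0 < d" "\<And>p h. norm h < d \<Longrightarrow> \<bar>g (p + h) - g p - ?D p h\<bar> \<le> e / K * norm h"
      using uniform_taylor[OF C V, of "e / K"] e K by auto
    have "norm (conv g f y - conv g f x - conv (\<lambda>p. ?D p (y - x)) f x) \<le> e * norm (y - x)"
      if y: "norm (y - x) < min d 1" for y
    proof -
      let ?h = "y - x"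
      let ?T = "\<lambda>w. g (y - w) - g (x - w) - ?D (x - w) ?h"
      have "conv g f y - conv g f x - conv (\<lambda>p. ?D p ?h) f x = (LINT w|lebesgue. ?T w *\<^sub>R f w)"
        unfolding conv_def using ig[of x] ig[of y] iD[of x "y - x"]
        by (simp add: scaleR_left_diff_distrib)
      also have "norm \<dots> \<le> (LINT w|lebesgue. (e / K * norm ?h) * norm (indicat_real ?S w *\<^sub>R f w))"
      proof (rule Bochner_Integration.integral_norm_bound_integral)
        show "integrable lebesgue (\<lambda>w. ?T w *\<^sub>R f w)"
          using ig[of x] ig[of y] iD[of x "y - x"] by (simp add: scaleR_left_diff_distrib)
        show "integrable lebesgue (\<lambda>w. (e / K * norm ?h) * norm (indicat_real ?S w *\<^sub>R f w))"
          using i by (intro integrable_mult_right integrable_norm)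
        fix w
        show "norm (?T w *\<^sub>R f w) \<le> (e / K * norm ?h) * norm (indicat_real ?S w *\<^sub>R f w)"
        proof (cases "w \<in> ?S")
          case True
          have "\<bar>?T w\<bar> \<le> e / K * norm ?h" using d(2)[of ?h "x - w"] y by (simp add: algebra_simps)
          then have "\<bar>?T w\<bar> * norm (f w) \<le> (e / K * norm ?h) * norm (f w)" by (rule mult_right_mono) simp
          then show ?thesis using True by simp
        next
          case False
          have "norm (x - w) \<le> norm (y - w) + norm (y - x)"
            by (metis dist_norm dist_triangle2 dist_commute add.commute)
          then have "R < norm (x - w)" "R < norm (y - w)" using False y by (auto simp: dist_norm)
          then have "?T w = 0" using V DV[of ?h] unfolding vanishes_outside_def by auto
          then show ?thesis using False by simp
        qed
      qed
      also have "\<dots> = e * norm ?h * ((K - 1) / K)" using i unfolding K_def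
        by simp
      also have "\<dots> \<le> e * norm ?h * 1" using e K by (intro mult_left_mono) auto
      finally show ?thesis by simp
    qed
    then show "\<exists>d>0. \<forall>y. norm (y - x) < d \<longrightarrow>
         norm (conv g f y - conv g f x - conv (\<lambda>p. ?D p (y - x)) f x) \<le> e * norm (y - x)"
      using d(1) by (intro exI[of _ "min d 1"]) auto
  qed
qed

lemma conv_continuous:
  fixes f :: "'a::euclidean_space \<Rightarrow> 'b::euclidean_space"
  assumes f: "locally_integrable f" and C: "Ck 1 g" and V: "vanishes_outside R g"
  shows "continuous_on UNIV (conv g f)"
  using conv_has_derivative[OF assms]
  by (intro continuous_at_imp_continuous_on) (auto intro: has_derivative_continuous)


section \<open>Curl of a convolution and the size of its gradient\<close>

lemma pd_conv:
  assumes "locally_integrable f" "Ck 1 g" "vanishes_outside R g"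
  shows "pd j (conv g f) x = conv (pd j g) f x"
  using frechet_derivative_at[OF conv_has_derivative[OF assms, of x], symmetric]
  by (simp add: pd_def[abs_def] fun_eq_iff)

lemma Ck_pd: "Ck (Suc k) g \<Longrightarrow> Ck k (pd j g)"
  by (simp add: pd_def[abs_def])

lemma vanishes_outside_pd: "vanishes_outside R g \<Longrightarrow> vanishes_outside R (pd j g)"
  using frechet_derivative_vanishes_outside by (simp add: pd_def[abs_def])

text \<open>As a finite sum of bounded linear maps applied to partial derivatives, the curl inherits
  differentiability, continuity and measurability term by term.\<close>

lemma curl_eq_cross3: "curl F x = (\<Sum>j\<in>UNIV. cross3 (axis j 1) (pd j F x))"
  by (simp add: vec_eq_iff forall_3 sum_3 curl_def cross3_def axis_def)

lemma bounded_linear_cross3: "bounded_linear (cross3 a)"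
  using bilinear_cross unfolding bilinear_def by (simp add: linear_conv_bounded_linear)

lemma curl_conv:
  assumes "locally_integrable f" "Ck 1 g" "vanishes_outside R g"
  shows "curl (conv g f) x = (\<Sum>j\<in>UNIV. cross3 (axis j 1) (conv (pd j g) f x))"
  unfolding curl_eq_cross3 pd_conv[OF assms] ..

text \<open>All derivatives, up to the second order, fall on the smooth kernel; of \<open>f\<close>
  only local integrability is asked.\<close>

lemma Ck_curl_conv:
  assumes f: "locally_integrable f" and C: "\<forall>k. Ck k g" and V: "vanishes_outside R g"
  shows "Ck 1 (curl (conv g f))"
proof -
  have C1: "Ck 1 g" and Cj: "\<And>k j. Ck k (pd j g)"
    using C Ck_pd by blast+
  have C1': "\<And>j. Ck 1 (pd j g)" using Cj by blast
  have C1v: "\<And>j v. Ck 1 (\<lambda>p. frechet_derivative (pd j g) (at p) v)"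
    using Cj Ck.simps(2) by blast
  note Vj = vanishes_outside_pd[OF V] and Vjv = frechet_derivative_vanishes_outside[OF vanishes_outside_pd[OF V]]
  have D: "(curl (conv g f) has_derivative
      (\<lambda>h. \<Sum>j\<in>UNIV. cross3 (axis j 1) (conv (\<lambda>p. frechet_derivative (pd j g) (at p) h) f x))) (at x)" for x
    unfolding curl_conv[OF f C1 V, abs_def]
    by (intro has_derivative_sum bounded_linear.has_derivative[OF bounded_linear_cross3]
        conv_has_derivative[OF f C1' Vj])
  have "continuous_on UNIV (\<lambda>x. frechet_derivative (curl (conv g f)) (at x) v)" for v
    unfolding frechet_derivative_at[OF D, symmetric]
    by (intro continuous_intros bounded_linear.continuous_on[OF bounded_linear_cross3] conv_continuous[OF f C1v Vjv])
  with D show ?thesis by (auto simp: differentiable_def)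
qed

text \<open>Each component of the derivative applied to \<open>v\<close> is the inner product of
  \<open>v\<close> with a row of the Jacobian; Cauchy-Schwarz row by row bounds the operator norm by
  the Frobenius norm.\<close>

lemma norm_frechet_derivative_le:
  fixes F :: "R3 \<Rightarrow> R3"
  assumes "F differentiable (at x)"
  shows "norm (frechet_derivative F (at x) v) \<le> sqrt (grad_norm_sq F x) * norm v"
proof -
  let ?D = "frechet_derivative F (at x)"
  have lin: "linear ?D" using assms frechet_derivative_works has_derivative_linear by blast
  have comp: "(?D v $ i)\<^sup>2 \<le> (\<Sum>j\<in>UNIV. (pd j F x $ i)\<^sup>2) * (norm v)\<^sup>2" for i
  proof -
    let ?w = "\<chi> j. pd j F x $ i"
    have "?D v = ?D (\<Sum>j\<in>UNIV. v $ j *\<^sub>R axis j 1)"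
      using basis_expansion[of v] by (simp add: scalar_mult_eq_scaleR)
    then have "?D v $ i = v \<bullet> ?w"
      by (simp add: linear_sum[OF lin] linear_cmul[OF lin] inner_vec_def pd_def)
    then have "(?D v $ i)\<^sup>2 \<le> (norm v)\<^sup>2 * (norm ?w)\<^sup>2"
      using Cauchy_Schwarz_ineq[of v ?w] by (simp add: power2_norm_eq_inner)
    also have "(norm ?w)\<^sup>2 = (\<Sum>j\<in>UNIV. (pd j F x $ i)\<^sup>2)"
      by (simp add: norm_vec_def L2_set_def sum_nonneg)
    finally show ?thesis by (simp add: mult.commute)
  qed
  have "(norm (?D v))\<^sup>2 = (\<Sum>i\<in>UNIV. (?D v $ i)\<^sup>2)"
    by (simp add: norm_vec_def L2_set_def sum_nonneg)
  also have "\<dots> \<le> grad_norm_sq F x * (norm v)\<^sup>2"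
    unfolding grad_norm_sq_def sum_distrib_right[of _ _ "(norm v)\<^sup>2"] by (intro sum_mono order_trans[OF comp]) (simp add: sum_distrib_right)
  finally have "sqrt ((norm (?D v))\<^sup>2) \<le> sqrt (grad_norm_sq F x * (norm v)\<^sup>2)" by (rule real_sqrt_le_mono)
  then show ?thesis by (simp add: real_sqrt_mult)
qed

lemma grad_norm_sq_nonneg: "0 \<le> grad_norm_sq F x"
  unfolding grad_norm_sq_def by (intro sum_nonneg) auto

lemma grad_norm_sq_continuous:
  assumes "Ck 1 F" shows "continuous_on UNIV (grad_norm_sq F)"
  using assms unfolding grad_norm_sq_def[abs_def] pd_def by (intro continuous_intros) auto

section \<open>Translation estimates and the singular kernel\<close>

text \<open>The fundamental theorem of calculus is applied to the scalar function
  \<open>w \<bullet> F\<close> along the segment, with \<open>w\<close> the total increment itself.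
  Its increment is then \<open>(norm w)^2\<close>, and Young's inequality lets half of it be
  absorbed, which replaces Cauchy-Schwarz for integrals. The right side is a nonnegative Lebesgue
  integral, ready for Tonelli.\<close>

lemma difference_sq_le:
  fixes F :: "R3 \<Rightarrow> R3"
  assumes "Ck 1 F"
  shows "ennreal ((norm (F x - F (x - z)))\<^sup>2)
    \<le> ennreal ((norm z)\<^sup>2) * (\<integral>\<^sup>+s. ennreal (grad_norm_sq F (x - s *\<^sub>R z)) * indicator {0..1} s \<partial>lborel)"
proof -
  let ?D = "\<lambda>x. frechet_derivative F (at x)"
  let ?G = "\<lambda>s. grad_norm_sq F (x - s *\<^sub>R z)"
  have diff: "(F has_derivative ?D x) (at x)" for x
    using assms frechet_derivative_works by auto
  define w where "w = F x - F (x - z)"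
  have contG: "continuous_on {0..1} ?G"
    by (intro continuous_on_compose2[OF grad_norm_sq_continuous[OF assms]] continuous_intros) auto
  have Gi: "(?G has_integral (integral {0..1} ?G)) {0..1}"
    using integrable_continuous_real[OF contG] by (rule integrable_integral)
  \<comment> \<open>The segment runs from \<open>x\<close> at \<open>s = 0\<close> to
    \<open>x - z\<close> at \<open>s = 1\<close>, hence the minus sign on the
    antiderivative.\<close>
  have "((\<lambda>s. w \<bullet> ?D (x - s *\<^sub>R z) z) has_integral
      ((\<lambda>s. - (w \<bullet> F (x - s *\<^sub>R z))) 1 - (\<lambda>s. - (w \<bullet> F (x - s *\<^sub>R z))) 0)) {0..1}"
  proof (rule fundamental_theorem_of_calculus)
    fix s :: real
    have "linear (?D (x - s *\<^sub>R z))" using diff has_derivative_linear by blast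
    moreover have "((\<lambda>s. F (x - s *\<^sub>R z)) has_derivative (\<lambda>h. ?D (x - s *\<^sub>R z) (- (h *\<^sub>R z)))) (at s within {0..1})"
      by (rule has_derivative_compose[OF _ diff]) (auto intro!: derivative_eq_intros)
    ultimately have "((\<lambda>s. F (x - s *\<^sub>R z)) has_vector_derivative - ?D (x - s *\<^sub>R z) z) (at s within {0..1})"
      unfolding has_vector_derivative_def by (simp add: linear_neg linear_cmul)
    from has_vector_derivative_minus[OF bounded_linear.has_vector_derivative[OF bounded_linear_inner_right this]]
    show "((\<lambda>s. - (w \<bullet> F (x - s *\<^sub>R z))) has_vector_derivative w \<bullet> ?D (x - s *\<^sub>R z) z) (at s within {0..1})"
      by simp
  qed simp
  then have hi: "((\<lambda>s. w \<bullet> ?D (x - s *\<^sub>R z) z) has_integral (norm w)\<^sup>2) {0..1}"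
    by (simp add: w_def power2_norm_eq_inner inner_diff_right)
  have "(norm w)\<^sup>2 \<le> (norm w)\<^sup>2 / 2 + (norm z)\<^sup>2 / 2 * integral {0..1} ?G"
  proof (rule has_integral_le[OF hi])
    have "((\<lambda>s. (norm w)\<^sup>2 / 2 + (norm z)\<^sup>2 / 2 * ?G s) has_integral
       ((norm w)\<^sup>2 / 2 * (1 - 0) + (norm z)\<^sup>2 / 2 * integral {0..1} ?G)) {0..1}"
      using has_integral_const_real[of "(norm w)\<^sup>2 / 2" 0 1]
      by (intro has_integral_add has_integral_mult_right[OF Gi]) simp
    then show "((\<lambda>s. (norm w)\<^sup>2 / 2 + (norm z)\<^sup>2 / 2 * ?G s) has_integral
       ((norm w)\<^sup>2 / 2 + (norm z)\<^sup>2 / 2 * integral {0..1} ?G)) {0..1}" by simp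
    fix s :: real
    let ?g = "sqrt (?G s) * norm z"
    have "w \<bullet> ?D (x - s *\<^sub>R z) z \<le> norm w * norm (?D (x - s *\<^sub>R z) z)" by (rule norm_cauchy_schwarz)
    also have "\<dots> \<le> norm w * ?g"
      using diff by (intro mult_left_mono norm_frechet_derivative_le) (auto simp: differentiable_def)
    also have "\<dots> \<le> (norm w)\<^sup>2 / 2 + ?g\<^sup>2 / 2"
      using sum_squares_bound[of "norm w" ?g] by simp
    also have "?g\<^sup>2 = (norm z)\<^sup>2 * ?G s" by (simp add: power_mult_distrib grad_norm_sq_nonneg)
    finally show "w \<bullet> ?D (x - s *\<^sub>R z) z \<le> (norm w)\<^sup>2 / 2 + (norm z)\<^sup>2 / 2 * ?G s" by simp
  qed
  then have "ennreal ((norm w)\<^sup>2) \<le> ennreal ((norm z)\<^sup>2 * integral {0..1} ?G)"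
    by (intro ennreal_leI) simp
  also have "\<dots> = ennreal ((norm z)\<^sup>2) * ennreal (integral {0..1} ?G)"
    by (simp add: ennreal_mult integral_nonneg integrable_continuous_real[OF contG] grad_norm_sq_nonneg)
  also have "ennreal (integral {0..1} ?G) = (\<integral>\<^sup>+s. ennreal (?G s) * indicator {0..1} s \<partial>lborel)"
    using Gi by (intro nn_integral_has_integral_lebesgue'[symmetric] grad_norm_sq_nonneg)
  finally show ?thesis by (simp add: w_def)
qed

text \<open>After exchanging the integrals over \<open>x\<close> and \<open>s\<close>, the shift by
  \<open>s *\<^sub>R z\<close> is undone by translation invariance. It has length at most
  \<open>d\<close>, and this is what enlarges the ball.\<close>

lemma translation_estimate:
  fixes F :: "R3 \<Rightarrow> R3"
  assumes C: "Ck 1 F" and z: "norm z \<le> d"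
  shows "(\<integral>\<^sup>+x. ennreal ((norm (F x - F (x - z)))\<^sup>2) * indicator (ball a r) x \<partial>lborel)
    \<le> ennreal ((norm z)\<^sup>2) * (\<integral>\<^sup>+x. ennreal (grad_norm_sq F x) * indicator (ball a (r + d)) x \<partial>lborel)"
proof -
  have [measurable]: "grad_norm_sq F \<in> borel_measurable borel"
    using grad_norm_sq_continuous[OF C] by (rule borel_measurable_continuous_onI)
  have [measurable]: "ball a R \<in> sets borel" for R :: real by simp
  let ?I = "\<integral>\<^sup>+x. ennreal (grad_norm_sq F x) * indicator (ball a (r + d)) x \<partial>lborel"
  have "(\<integral>\<^sup>+x. ennreal ((norm (F x - F (x - z)))\<^sup>2) * indicator (ball a r) x \<partial>lborel)
     \<le> (\<integral>\<^sup>+x. ennreal ((norm z)\<^sup>2) * (\<integral>\<^sup>+s. ennreal (grad_norm_sq F (x - s *\<^sub>R z)) * indicator {0..1} s * indicator (ball a r) x \<partial>lborel) \<partial>lborel)"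
    using difference_sq_le[OF C, of _ z] by (intro nn_integral_mono) (auto simp: indicator_def)
  also have "\<dots> = ennreal ((norm z)\<^sup>2) * (\<integral>\<^sup>+x. (\<integral>\<^sup>+s. ennreal (grad_norm_sq F (x - s *\<^sub>R z)) * indicator {0..1} s * indicator (ball a r) x \<partial>lborel) \<partial>lborel)"
    by (rule nn_integral_cmult) measurable
  also have "(\<integral>\<^sup>+x. (\<integral>\<^sup>+s. ennreal (grad_norm_sq F (x - s *\<^sub>R z)) * indicator {0..1} s * indicator (ball a r) x \<partial>lborel) \<partial>lborel)
      = (\<integral>\<^sup>+s. (\<integral>\<^sup>+x. ennreal (grad_norm_sq F (x - s *\<^sub>R z)) * indicator {0..1} s * indicator (ball a r) x \<partial>lborel) \<partial>lborel)"
    by (rule lborel_pair.Fubini'[symmetric]) measurable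
  also have "\<dots> \<le> (\<integral>\<^sup>+s. ?I * indicator {0..1::real} s \<partial>lborel)"
  proof (intro nn_integral_mono)
    fix s :: real
    show "(\<integral>\<^sup>+x. ennreal (grad_norm_sq F (x - s *\<^sub>R z)) * indicator {0..1} s * indicator (ball a r) x \<partial>lborel) \<le> ?I * indicator {0..1} s"
    proof (cases "s \<in> {0..1}")
      case True
      have "s * norm z \<le> 1 * d" using True z by (intro mult_mono) auto
      then have in_ball: "x - s *\<^sub>R z \<in> ball a (r + d)" if "x \<in> ball a r" for x
        using that True norm_triangle_ineq[of "a - x" "s *\<^sub>R z"] by (auto simp: dist_norm algebra_simps)
      have "?I = (\<integral>\<^sup>+x. ennreal (grad_norm_sq F x) * indicator (ball a (r + d)) x \<partial>distr lborel borel ((+) (- (s *\<^sub>R z))))"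
        unfolding lborel_distr_plus ..
      also have "\<dots> = (\<integral>\<^sup>+x. ennreal (grad_norm_sq F (x - s *\<^sub>R z)) * indicator (ball a (r + d)) (x - s *\<^sub>R z) \<partial>lborel)"
        by (subst nn_integral_distr) auto
      finally show ?thesis using True in_ball
        by (auto intro!: nn_integral_mono simp: indicator_def)
    qed auto
  qed
  also have "\<dots> = ?I" by (simp add: nn_integral_cmult)
  finally show ?thesis by (simp add: mult_left_mono)
qed


section \<open>Borel representatives\<close>

text \<open>A parametric integral of a jointly Borel integrand is Borel. The integral is moved from
  the completed measure to \<open>lborel\<close>, where the product measurability rules
  apply.\<close>

lemma conv_measurable:
  fixes v :: "'a::euclidean_space \<times> real \<Rightarrow> 'b::euclidean_space"
  assumes [measurable]: "g \<in> borel_measurable borel" "v \<in> borel_measurable borel"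
  shows "(\<lambda>p. conv g (\<lambda>y. v (y, snd p)) (fst p)) \<in> borel_measurable borel"
proof -
  have [measurable]: "v \<in> borel_measurable (borel \<Otimes>\<^sub>M borel)" using assms(2) by (simp add: borel_prod)
  have "(\<lambda>p. LINT y|lborel. g (fst p - y) *\<^sub>R v (y, snd p)) \<in> borel_measurable (borel \<Otimes>\<^sub>M borel)"
    by measurable
  moreover have "conv g (\<lambda>y. v (y, t)) x = (LINT y|lborel. g (x - y) *\<^sub>R v (y, t))" for x t
    unfolding conv_def by (rule integral_completion) measurable
  ultimately show ?thesis by (simp add: borel_prod)
qed

lemma conv_cong_AE:
  assumes "continuous_on UNIV g" "f \<in> borel_measurable lebesgue" "f' \<in> borel_measurable lebesgue"
    and "AE y in lebesgue. f y = f' y"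
  shows "conv g f x = conv g f' x"
  unfolding conv_def
proof (rule integral_cong_AE)
  have "(\<lambda>y. g (x - y)) \<in> borel_measurable lebesgue"
    unfolding measurable_lborel1[symmetric]
    by (intro measurable_completion) (auto intro!: borel_measurable_continuous_onI continuous_on_compose2[OF assms(1)] continuous_intros)
  then show "(\<lambda>y. g (x - y) *\<^sub>R f y) \<in> borel_measurable lebesgue" "(\<lambda>y. g (x - y) *\<^sub>R f' y) \<in> borel_measurable lebesgue"
    using assms(2,3) by (auto intro!: borel_measurable_scaleR)
qed (use assms(4) in auto)

lemma in_L2_cong_AE:
  assumes "in_L2 f" "f' \<in> borel_measurable lebesgue" "AE x in lebesgue. f x = f' x"
  shows "in_L2 f'"
  using assms unfolding in_L2_def
  by (auto intro: integrable_cong_AE_imp)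

lemma lebesgue_vec_ex_borel:
  fixes w :: "'a::euclidean_space \<Rightarrow> real^'n"
  assumes "w \<in> borel_measurable lebesgue"
  obtains w' where "w' \<in> borel_measurable borel" "AE p in lborel. w p = w' p"
proof -
  have "(\<lambda>p. w p $ i) \<in> borel_measurable lebesgue" for i
    unfolding cart_eq_inner_axis by (intro borel_measurable_inner assms) simp
  then have "\<forall>i. \<exists>g. g \<in> borel_measurable lborel \<and> (AE p in lborel. w p $ i = g p)"
    using completion_ex_borel_measurable_real by blast
  then obtain g where "\<forall>i. g i \<in> borel_measurable lborel \<and> (AE p in lborel. w p $ i = g i p)"
    unfolding choice_iff by blast
  then have g: "\<And>i. g i \<in> borel_measurable borel" "\<And>i. AE p in lborel. w p $ i = g i p"
    by auto
  have eq: "x = (\<Sum>i\<in>UNIV. x $ i *\<^sub>R axis i 1)" for x :: "real^'n"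
    using basis_expansion[of x] by (simp add: scalar_mult_eq_scaleR)
  have "AE p in lborel. \<forall>i. w p $ i = g i p" using g(2) by (simp add: AE_all_countable)
  then have "AE p in lborel. w p = (\<Sum>i\<in>UNIV. g i p *\<^sub>R axis i 1)"
    by eventually_elim (metis (no_types, lifting) eq sum.cong)
  moreover have "(\<lambda>p. \<Sum>i\<in>UNIV. g i p *\<^sub>R (axis i 1 :: real^'n)) \<in> borel_measurable borel"
    using g(1) by measurable
  ultimately show thesis using that by blast
qed

text \<open>A Borel version of \<open>u\<close> on space-time differs from it inside a Borel null
  set \<open>Z\<close>, and by Tonelli almost every time slice of \<open>Z\<close> is null. Times
  with a bad slice, or with \<open>u\<close> not in L2, are collected in \<open>N\<close>.\<close>

lemma Linf_L2_borel_representative: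
  assumes u: "in_Linf_L2 I u" and I: "I \<in> sets borel"
  obtains v N where "v \<in> borel_measurable borel" "N \<in> null_sets lborel" "\<And>t. in_L2 (\<lambda>x. v (x, t))"
    "\<And>t. t \<in> I - N \<Longrightarrow> in_L2 (\<lambda>x. u (x, t))"
    "\<And>t. t \<in> I - N \<Longrightarrow> AE x in lebesgue. u (x, t) = v (x, t)"
proof -
  have S: "UNIV \<times> I \<in> sets (lborel :: (R3 \<times> real) measure)"
    using I by (auto simp: borel_prod[symmetric])
  then have S': "(UNIV :: R3 set) \<times> I \<in> sets lebesgue" by auto
  define w where "w p = (if p \<in> UNIV \<times> I then u p else 0)" for p
  have "w \<in> borel_measurable lebesgue"
    using u S' measurable_restrict_space_iff[of "UNIV \<times> I" lebesgue 0 borel u]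
    unfolding in_Linf_L2_def w_def[abs_def] by auto
  then obtain w' where w': "w' \<in> borel_measurable borel" "AE p in lborel. w p = w' p"
    using lebesgue_vec_ex_borel by blast
  then obtain Z where Z: "Z \<in> null_sets lborel" "{p. w p \<noteq> w' p} \<subseteq> Z"
    by (auto simp: eventually_ae_filter)
  have Zm: "Z \<in> sets (borel \<Otimes>\<^sub>M borel)" using null_setsD2[OF Z(1)] unfolding borel_prod sets_lborel .
  have "AE p in lborel \<Otimes>\<^sub>M lborel. p \<notin> Z" unfolding lborel_prod by (rule AE_not_in[OF Z(1)])
  then have "AE x in lborel. AE t in lborel. (x, t) \<notin> Z" by (rule lborel_pair.AE_pair)
  then have "AE t in lborel. AE x in lborel. (x, t) \<notin> Z"
    by (subst (asm) lborel_pair.AE_commute) (use Zm in measurable)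
  moreover have "AE t in lborel. t \<in> I \<longrightarrow> in_L2 (\<lambda>x. u (x, t))"
  proof -
    obtain C where "AE t in lebesgue_on I. in_L2 (\<lambda>x. u (x, t)) \<and> L2norm (\<lambda>x. u (x, t)) \<le> C"
      using u unfolding in_Linf_L2_def by blast
    then have "AE t in lebesgue_on I. in_L2 (\<lambda>x. u (x, t))" by eventually_elim simp
    then show ?thesis using I by (subst (asm) AE_restrict_space_iff) (auto simp: AE_completion_iff)
  qed
  ultimately have "AE t in lborel. (AE x in lborel. (x, t) \<notin> Z) \<and> (t \<in> I \<longrightarrow> in_L2 (\<lambda>x. u (x, t)))"
    by eventually_elim simp
  then obtain N where N: "N \<in> null_sets lborel"
    "{t. \<not> ((AE x in lborel. (x, t) \<notin> Z) \<and> (t \<in> I \<longrightarrow> in_L2 (\<lambda>x. u (x, t))))} \<subseteq> N"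
    by (auto simp: eventually_ae_filter)
  \<comment> \<open>Setting \<open>v\<close> to zero at the exceptional times and outside
    \<open>I\<close> puts every slice in L2, so the filtered field of \<open>v\<close> is smooth at
    all times. \<open>N\<close> is a Borel set, which keeps \<open>v\<close> Borel.\<close>
  define v where "v p = (if p \<in> UNIV \<times> (I - N) then w' p else 0)" for p
  have "UNIV \<times> (I - N) \<in> sets (borel :: (R3 \<times> real) measure)"
    using I N(1) by (auto simp: borel_prod[symmetric] null_sets_def)
  then have vm: "v \<in> borel_measurable borel"
    unfolding v_def[abs_def] using w'(1) by (intro measurable_If_set) auto
  have good: "in_L2 (\<lambda>x. u (x, t))" "AE x in lebesgue. u (x, t) = v (x, t)" if t: "t \<in> I - N" for t
  proof -
    show "in_L2 (\<lambda>x. u (x, t))" using t N(2) by auto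
    have "AE x in lborel. (x, t) \<notin> Z" using t N(2) by auto
    then have "AE x in lborel. u (x, t) = v (x, t)"
    proof eventually_elim
      case (elim x)
      then have "w (x, t) = w' (x, t)" using Z(2) by blast
      then show ?case using t by (simp add: v_def w_def)
    qed
    then show "AE x in lebesgue. u (x, t) = v (x, t)" by (rule AE_completion)
  qed
  have slice: "(\<lambda>x. v (x, t)) \<in> borel_measurable lebesgue" for t
  proof -
    have "(\<lambda>x :: R3. (x, t)) \<in> borel_measurable borel"
      by (intro borel_measurable_continuous_onI continuous_intros)
    from measurable_compose[OF this vm] have "(\<lambda>x. v (x, t)) \<in> borel_measurable lborel" by simp
    then show ?thesis by (rule measurable_completion)
  qed
  have "in_L2 (\<lambda>x. v (x, t))" for t
  proof (cases "t \<in> I - N")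
    case True then show ?thesis using good slice in_L2_cong_AE by blast
  next
    case False
    then have "(\<lambda>x. v (x, t)) = (\<lambda>_. 0)" unfolding v_def by auto
    then show ?thesis by (simp add: in_L2_def)
  qed
  with vm N(1) good that show thesis by blast
qed

section \<open>Mass of the rescaled kernel\<close>

lemma kernel_scaling:
  assumes [measurable]: "\<theta> \<in> borel_measurable borel" and V: "\<And>w. w \<notin> ball 0 1 \<Longrightarrow> \<theta> w = 0" and s: "0 < s"
  shows "(\<integral>\<^sup>+z. ennreal (\<theta> (z /\<^sub>R s) / (norm z)\<^sup>2) \<partial>lborel) = ennreal s * C_theta \<theta>"
proof -
  have [measurable]: "ball 0 1 \<in> sets (borel :: R3 measure)" by simp
  have "(\<integral>\<^sup>+z. ennreal (\<theta> (z /\<^sub>R s) / (norm z)\<^sup>2) \<partial>lborel)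
      = (\<integral>\<^sup>+z. ennreal (\<theta> (z /\<^sub>R s) / (norm z)\<^sup>2) \<partial>density (distr lborel borel (\<lambda>x. 0 + s *\<^sub>R x)) (\<lambda>_. ennreal (\<bar>s\<bar>^DIM(R3))))"
    using s lborel_affine[of s "0 :: R3"] by simp
  also have "\<dots> = (\<integral>\<^sup>+w. ennreal (s ^ 3) * ennreal (\<theta> (s *\<^sub>R w /\<^sub>R s) / (norm (s *\<^sub>R w))\<^sup>2) \<partial>lborel)"
    using s by (subst nn_integral_density, simp, simp, subst nn_integral_distr) auto
  also have "\<dots> = (\<integral>\<^sup>+w. ennreal s * (ennreal (\<theta> w / (norm w)\<^sup>2) * indicator (ball 0 1) w) \<partial>lborel)"
  proof (intro nn_integral_cong)
    fix w :: R3
    \<comment> \<open>The Jacobian \<open>s ^ 3\<close> against the weight's \<open>s ^ 2\<close>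
      leaves one factor \<open>s\<close>; at \<open>w = 0\<close> both sides are zero by the
      convention for division.\<close>
    have "s ^ 3 * (\<theta> (s *\<^sub>R w /\<^sub>R s) / (norm (s *\<^sub>R w))\<^sup>2) = s * (\<theta> w / (norm w)\<^sup>2)"
      using s by (simp add: power2_eq_square power3_eq_cube field_simps)
    then have "ennreal (s ^ 3) * ennreal (\<theta> (s *\<^sub>R w /\<^sub>R s) / (norm (s *\<^sub>R w))\<^sup>2) = ennreal s * ennreal (\<theta> w / (norm w)\<^sup>2)"
      using s by (simp add: ennreal_mult'[symmetric])
    then show "ennreal (s ^ 3) * ennreal (\<theta> (s *\<^sub>R w /\<^sub>R s) / (norm (s *\<^sub>R w))\<^sup>2) = ennreal s * (ennreal (\<theta> w / (norm w)\<^sup>2) * indicator (ball 0 1) w)"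
      using V[of w] by (cases "w \<in> ball 0 1") auto
  qed
  also have "\<dots> = ennreal s * C_theta \<theta>"
    unfolding C_theta_def nn_integral_completion by (rule nn_integral_cmult) auto
  finally show ?thesis .
qed

text \<open>Needed to divide by the kernel mass. If the integral vanished, a nonempty open set on
  which the integrand is positive would be null.\<close>

lemma C_theta_pos:
  assumes [measurable]: "\<theta> \<in> borel_measurable borel" and one: "\<forall>w\<in>ball 0 (1/2). \<theta> w = 1"
  shows "0 < C_theta \<theta>"
proof (rule ccontr)
  have [measurable]: "ball 0 1 \<in> sets (borel :: R3 measure)" by simp
  assume "\<not> 0 < C_theta \<theta>"
  then have "(\<integral>\<^sup>+w. ennreal (\<theta> w / (norm w)\<^sup>2) * indicator (ball 0 1) w \<partial>lborel) = 0"
    by (simp add: C_theta_def nn_integral_completion)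
  then have "AE w in lborel. ennreal (\<theta> w / (norm w)\<^sup>2) * indicator (ball 0 1) w = 0"
    by (subst (asm) nn_integral_0_iff_AE) auto
  \<comment> \<open>The origin is removed because division by zero makes the integrand vanish
    there.\<close>
  then have "AE w in lborel. w \<notin> ball 0 (1/2) - {0 :: R3}"
    by eventually_elim (use one in \<open>auto simp: indicator_def ennreal_eq_0_iff split: if_splits\<close>)
  then have "ball 0 (1/2) - {0 :: R3} \<in> null_sets lborel"
    by (subst (asm) AE_iff_null_sets[symmetric]) auto
  then have "negligible (ball 0 (1/2) - {0 :: R3})"
    by (auto simp: negligible_iff_null_sets intro: null_sets_completionI)
  then have "ball 0 (1/2) - {0 :: R3} = {}"
    using open_not_negligible[of "ball 0 (1/2) - {0 :: R3}"] by (auto simp: open_Diff)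
  moreover have "(1/4) *\<^sub>R axis 1 1 \<in> ball 0 (1/2) - {0 :: R3}" by (simp add: axis_eq_0_iff)
  ultimately show False by blast
qed


section \<open>The direction defect\<close>

text \<open>Multiplying by \<open>norm b\<close> turns the difference of directions into
  \<open>norm b *\<^sub>R sgn a - b\<close>, which is
  \<open>(norm b - norm a) *\<^sub>R sgn a\<close> plus \<open>a - b\<close>; each summand has norm
  at most \<open>norm (a - b)\<close>.\<close>

lemma norm_sgn_diff_mult_le:
  fixes a b :: "'a::real_normed_vector"
  assumes "a \<noteq> 0"
  shows "norm (sgn a - sgn b) * norm b \<le> 2 * norm (a - b)"
proof -
  have a: "norm a *\<^sub>R sgn a = a" and b: "norm b *\<^sub>R sgn b = b"
    by (cases "a = 0"; cases "b = 0"; simp add: sgn_div_norm)+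
  have "norm (sgn a - sgn b) * norm b = norm (norm b *\<^sub>R sgn a - b)"
    using b by (metis norm_ge_zero abs_of_nonneg mult.commute norm_scaleR scaleR_right_diff_distrib)
  also have "norm b *\<^sub>R sgn a - b = (norm b - norm a) *\<^sub>R sgn a + (a - b)"
    using a by (simp add: scaleR_left_diff_distrib)
  also have "norm \<dots> \<le> \<bar>norm b - norm a\<bar> * norm (sgn a) + norm (a - b)"
    using norm_triangle_ineq by (metis norm_scaleR)
  also have "\<bar>norm b - norm a\<bar> * norm (sgn a) \<le> norm (a - b)"
    using assms norm_triangle_ineq3[of a b] by (simp add: norm_sgn abs_minus_commute)
  finally show ?thesis by simp
qed

lemma xi_eq_sgn: "xi \<phi> l u x t = sgn (Omega \<phi> l u x t)"
  by (simp add: xi_def sgn_div_norm)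

text \<open>The density in \<open>x\<close> of a truncated Gagliardo-type energy with singularity
  \<open>1 / norm z ^ 4\<close>. Weight and squared quotient are kept apart because the weight is
  integrated out separately at the end.\<close>

definition diff_quotient_energy :: "(R3 \<Rightarrow> real) \<Rightarrow> real \<Rightarrow> (R3 \<Rightarrow> R3) \<Rightarrow> R3 \<Rightarrow> ennreal" where
  "diff_quotient_energy \<theta> s F x = (\<integral>\<^sup>+z. ennreal (\<theta> (z /\<^sub>R s) / (norm z)\<^sup>2)
     * ennreal ((norm (F x - F (x - z)))\<^sup>2 / (norm z)\<^sup>2) \<partial>lborel)"

text \<open>Every truncated integral is below the same untruncated majorant, so the supremum over
  \<open>\<delta>\<close> costs nothing. \<open>c\<close> vanishes with \<open>F x\<close>, where
  there is no direction to compare. The parameter \<open>\<alpha>\<close> stays free and is later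
  taken as \<open>\<eta> / W\<close>.\<close>

lemma pair_inner_bound:
  assumes [measurable]: "\<theta> \<in> borel_measurable borel" "F \<in> borel_measurable borel"
    and \<theta>: "\<And>w. 0 \<le> \<theta> w" "\<And>w. w \<notin> ball 0 1 \<Longrightarrow> \<theta> w = 0"
    and s: "0 < \<rho> * r" and F: "\<And>y. Omega \<phi> l u y t = F y"
    and \<alpha>: "0 < \<alpha>" and c: "0 \<le> c" "F x = 0 \<Longrightarrow> c = 0"
  shows "ennreal c * pair_inner \<phi> \<theta> r \<rho> l u x t
    \<le> ennreal \<alpha> * diff_quotient_energy \<theta> (\<rho> * r) F x + ennreal (c\<^sup>2 / \<alpha>) * (ennreal (\<rho> * r) * C_theta \<theta>)"
proof -
  let ?s = "\<rho> * r"
  let ?k = "\<lambda>z. \<theta> (z /\<^sub>R ?s) / (norm z)\<^sup>2"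
  let ?q = "\<lambda>z. (norm (F x - F (x - z)))\<^sup>2 / (norm z)\<^sup>2"
  have [measurable]: "(\<lambda>z. sgn (F (x - z))) \<in> borel_measurable borel"
    unfolding sgn_div_norm by measurable
  let ?f = "\<lambda>z. \<theta> (z /\<^sub>R ?s) * (norm (sgn (F x) - sgn (F (x - z))) * norm (F (x - z)) / norm z ^ 3)"
  have pw: "c * ?f z \<le> \<alpha> * (?k z * ?q z) + c\<^sup>2 / \<alpha> * ?k z" if z: "z \<noteq> 0" for z
  proof (cases "F x = 0")
    case True
    then show ?thesis using c \<theta>(1) \<alpha> by simp
  next
    case False
    define m where "m = norm (F x - F (x - z)) / norm z"
    have "norm (sgn (F x) - sgn (F (x - z))) * norm (F (x - z)) / norm z ^ 3
        \<le> 2 * norm (F x - F (x - z)) / norm z ^ 3"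
      by (intro divide_right_mono norm_sgn_diff_mult_le False) simp
    also have "\<dots> = 2 * m / (norm z)\<^sup>2" using z by (simp add: m_def power2_eq_square power3_eq_cube)
    finally have "c * ?f z \<le> c * (\<theta> (z /\<^sub>R ?s) * (2 * m / (norm z)\<^sup>2))"
      using c \<theta>(1) by (intro mult_left_mono) auto
    also have "\<dots> = ?k z * (2 * c * m)" by simp
    also have "2 * c * m \<le> \<alpha> * m\<^sup>2 + c\<^sup>2 / \<alpha>"
    proof -
      have "0 \<le> (\<alpha> * m - c)\<^sup>2 / \<alpha>" using \<alpha> by simp
      also have "\<dots> = \<alpha> * m\<^sup>2 + c\<^sup>2 / \<alpha> - 2 * c * m"
        using \<alpha> by (simp add: field_simps power2_eq_square)
      finally show ?thesis by simp
    qed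
    then have "?k z * (2 * c * m) \<le> ?k z * (\<alpha> * m\<^sup>2 + c\<^sup>2 / \<alpha>)"
      using \<theta>(1) by (intro mult_left_mono) auto
    also have "m\<^sup>2 = ?q z" by (simp add: m_def power_divide)
    finally show ?thesis by (simp add: algebra_simps)
  qed
  have split_sum: "ennreal (\<alpha> * (k * q) + d * k) = ennreal \<alpha> * (ennreal k * ennreal q) + ennreal d * ennreal k"
    if "0 \<le> k" "0 \<le> q" "0 \<le> d" for k q d
    using that \<alpha> by (simp add: ennreal_plus ennreal_mult)
  have "ennreal c * pair_inner \<phi> \<theta> r \<rho> l u x t
      = (SUP \<delta>\<in>{0<..}. ennreal c * (\<integral>\<^sup>+z\<in>{z. \<delta> < norm z}. ennreal (?f z) \<partial>lborel))"
    unfolding pair_inner_def SUP_mult_left_ennreal nn_integral_completion xi_eq_sgn F ..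
  also have "\<dots> \<le> (\<integral>\<^sup>+z. ennreal \<alpha> * (ennreal (?k z) * ennreal (?q z)) + ennreal (c\<^sup>2 / \<alpha>) * ennreal (?k z) \<partial>lborel)"
  proof (rule SUP_least)
    fix \<delta> :: real assume \<delta>: "\<delta> \<in> {0<..}"
    have "ennreal c * (\<integral>\<^sup>+z\<in>{z. \<delta> < norm z}. ennreal (?f z) \<partial>lborel)
      = (\<integral>\<^sup>+z. ennreal c * (ennreal (?f z) * indicator {z. \<delta> < norm z} z) \<partial>lborel)"
      by (rule nn_integral_cmult[symmetric]) measurable
    also have "\<dots> \<le> (\<integral>\<^sup>+z. ennreal \<alpha> * (ennreal (?k z) * ennreal (?q z)) + ennreal (c\<^sup>2 / \<alpha>) * ennreal (?k z) \<partial>lborel)"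
    proof (intro nn_integral_mono)
      fix z :: R3
      show "ennreal c * (ennreal (?f z) * indicator {z. \<delta> < norm z} z)
        \<le> ennreal \<alpha> * (ennreal (?k z) * ennreal (?q z)) + ennreal (c\<^sup>2 / \<alpha>) * ennreal (?k z)"
      proof (cases "\<delta> < norm z")
        case True
        \<comment> \<open>The truncation excludes the origin, the one point where the pointwise
          inequality has not been shown.\<close>
        then have "z \<noteq> 0" using \<delta> by auto
        have "ennreal c * ennreal (?f z) = ennreal (c * ?f z)"
          by (rule ennreal_mult'[OF c(1), symmetric])
        also have "\<dots> \<le> ennreal (\<alpha> * (?k z * ?q z) + c\<^sup>2 / \<alpha> * ?k z)"
          by (intro ennreal_leI pw) fact
        also have "\<dots> = ennreal \<alpha> * (ennreal (?k z) * ennreal (?q z)) + ennreal (c\<^sup>2 / \<alpha>) * ennreal (?k z)"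
          using \<theta>(1) \<alpha> by (intro split_sum) auto
        finally show ?thesis using True by simp
      qed simp
    qed
    finally show "ennreal c * (\<integral>\<^sup>+z\<in>{z. \<delta> < norm z}. ennreal (?f z) \<partial>lborel) \<le> \<dots>" .
  qed
  also have "\<dots> = ennreal \<alpha> * diff_quotient_energy \<theta> ?s F x
      + ennreal (c\<^sup>2 / \<alpha>) * (\<integral>\<^sup>+z. ennreal (?k z) \<partial>lborel)"
    unfolding diff_quotient_energy_def
    by (subst nn_integral_add, measurable, subst nn_integral_cmult, measurable, subst nn_integral_cmult, measurable)
  also note kernel_scaling[OF assms(1) \<theta>(2) s]
  finally show ?thesis .
qed

text \<open>With the \<open>z\<close> integral outermost, each shift in the support of the kernel
  has length at most \<open>s\<close>; the factor \<open>(norm z)^2\<close> from the translation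
  estimate cancels the denominator of the quotient, and only the mass of the kernel is left.\<close>

lemma diff_quotient_energy_integral_le:
  assumes [measurable]: "\<theta> \<in> borel_measurable borel"
    and \<theta>: "\<And>w. 0 \<le> \<theta> w" "\<And>w. w \<notin> ball 0 1 \<Longrightarrow> \<theta> w = 0"
    and s: "0 < s" and F: "Ck 1 F"
  shows "(\<integral>\<^sup>+x. diff_quotient_energy \<theta> s F x * indicator (ball a r) x \<partial>lborel)
    \<le> ennreal s * C_theta \<theta> * (\<integral>\<^sup>+x. ennreal (grad_norm_sq F x) * indicator (ball a (r + s)) x \<partial>lborel)"
proof -
  let ?k = "\<lambda>z. ennreal (\<theta> (z /\<^sub>R s) / (norm z)\<^sup>2)"
  let ?I = "\<integral>\<^sup>+x. ennreal (grad_norm_sq F x) * indicator (ball a (r + s)) x \<partial>lborel"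
  have [measurable]: "ball a r \<in> sets borel" by simp
  have [measurable]: "F \<in> borel_measurable borel"
    using Ck_mono[of 0 F] F by (intro borel_measurable_continuous_onI) simp
  have "(\<integral>\<^sup>+x. diff_quotient_energy \<theta> s F x * indicator (ball a r) x \<partial>lborel)
    = (\<integral>\<^sup>+x. (\<integral>\<^sup>+z. ?k z * ennreal ((norm (F x - F (x - z)))\<^sup>2 / (norm z)\<^sup>2) * indicator (ball a r) x \<partial>lborel) \<partial>lborel)"
    unfolding diff_quotient_energy_def by (intro nn_integral_cong nn_integral_multc[symmetric]) measurable
  also have "\<dots> = (\<integral>\<^sup>+z. (\<integral>\<^sup>+x. ?k z * ennreal ((norm (F x - F (x - z)))\<^sup>2 / (norm z)\<^sup>2) * indicator (ball a r) x \<partial>lborel) \<partial>lborel)"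
    by (rule lborel_pair.Fubini'[symmetric]) measurable
  also have "\<dots> \<le> (\<integral>\<^sup>+z. ?k z * ?I \<partial>lborel)"
  proof (rule nn_integral_mono)
    fix z :: R3
    show "(\<integral>\<^sup>+x. ?k z * ennreal ((norm (F x - F (x - z)))\<^sup>2 / (norm z)\<^sup>2) * indicator (ball a r) x \<partial>lborel) \<le> ?k z * ?I"
    proof (cases "z /\<^sub>R s \<in> ball 0 1 \<and> z \<noteq> 0")
      case True
      then have z: "norm z \<le> s" "z \<noteq> 0" using s by (auto simp: field_simps)
      have q: "ennreal ((norm (F x - F (x - z)))\<^sup>2 / (norm z)\<^sup>2)
          = ennreal (1 / (norm z)\<^sup>2) * ennreal ((norm (F x - F (x - z)))\<^sup>2)" for x
        by (simp add: ennreal_mult'[symmetric])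
      have "(\<integral>\<^sup>+x. ?k z * ennreal ((norm (F x - F (x - z)))\<^sup>2 / (norm z)\<^sup>2) * indicator (ball a r) x \<partial>lborel)
        = (\<integral>\<^sup>+x. (?k z * ennreal (1 / (norm z)\<^sup>2)) * (ennreal ((norm (F x - F (x - z)))\<^sup>2) * indicator (ball a r) x) \<partial>lborel)"
        by (simp only: q mult.assoc)
      also have "\<dots> = (?k z * ennreal (1 / (norm z)\<^sup>2)) * (\<integral>\<^sup>+x. ennreal ((norm (F x - F (x - z)))\<^sup>2) * indicator (ball a r) x \<partial>lborel)"
        by (rule nn_integral_cmult) measurable
      also have "\<dots> \<le> (?k z * ennreal (1 / (norm z)\<^sup>2)) * (ennreal ((norm z)\<^sup>2) * ?I)"
        by (intro mult_left_mono translation_estimate F z) simp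
      also have "\<dots> = ?k z * ((ennreal (1 / (norm z)\<^sup>2) * ennreal ((norm z)\<^sup>2)) * ?I)"
        by (simp only: mult.assoc)
      also have "ennreal (1 / (norm z)\<^sup>2) * ennreal ((norm z)\<^sup>2) = 1"
        using z by (simp add: ennreal_mult'[symmetric])
      also have "?k z * (1 * ?I) = ?k z * ?I" by simp
      finally show ?thesis .
    next
      case False
      \<comment> \<open>Outside the support the cutoff vanishes; at \<open>z = 0\<close> the weight
        is zero by the convention for division.\<close>
      then have "?k z = 0" using \<theta>(2) by auto
      then show ?thesis by simp
    qed
  qed
  also have "\<dots> = (\<integral>\<^sup>+z. ?k z \<partial>lborel) * ?I" by (rule nn_integral_multc) measurable
  also note kernel_scaling[OF assms(1) \<theta>(2) s]
  finally show ?thesis .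
qed

section \<open>The filtered vorticity\<close>

lemma AE_snd:
  assumes "AE t in lborel. P t"
  shows "AE p in (lborel :: ('a::euclidean_space \<times> 'b::euclidean_space) measure). P (snd p)"
proof -
  obtain N where N: "N \<in> null_sets lborel" "{t. \<not> P t} \<subseteq> N" using assms by (auto simp: eventually_ae_filter)
  have "(UNIV :: 'a set) \<times> N \<in> null_sets (lborel \<Otimes>\<^sub>M lborel)"
    using N(1) by (intro lborel.times_in_null_sets2) auto
  then have "(UNIV :: 'a set) \<times> N \<in> null_sets lborel" unfolding lborel_prod .
  then show ?thesis by (rule AE_I') (use N(2) in auto)
qed

lemma filter_conv_eq_conv: "filter_conv \<phi> l = conv (\<lambda>p. (1 / l ^ 3) * \<phi> (inverse l *\<^sub>R p))"
  by (intro ext) (simp add: filter_conv_def conv_def)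

lemma Cc_infty_scaled:
  fixes \<phi> :: "'a::real_normed_vector \<Rightarrow> real"
  assumes "Cc_infty (ball 0 1) \<phi>" "0 < l"
  shows "\<forall>k. Ck k (\<lambda>p. c * \<phi> (inverse l *\<^sub>R p))"
    and "vanishes_outside l (\<lambda>p. c * \<phi> (inverse l *\<^sub>R p))"
proof -
  show "\<forall>k. Ck k (\<lambda>p. c * \<phi> (inverse l *\<^sub>R p))" using assms Ck_scale unfolding Cc_infty_def by blast
  show "vanishes_outside l (\<lambda>p. c * \<phi> (inverse l *\<^sub>R p))"
    unfolding vanishes_outside_def
  proof (intro allI impI)
    fix x :: 'a assume "l < norm x"
    then have "inverse l *\<^sub>R x \<notin> ball 0 1" using assms(2) by (simp add: field_simps)
    then have "\<phi> (inverse l *\<^sub>R x) = 0"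
      using assms(1) closure_subset[of "{x. \<phi> x \<noteq> 0}"] unfolding Cc_infty_def by blast
    then show "c * \<phi> (inverse l *\<^sub>R x) = 0" by simp
  qed
qed

text \<open>The set where the bound fails is open and null, hence empty. This turns essential
  supremum bounds into bounds at every point.\<close>

lemma continuous_AE_le_imp_le:
  fixes h :: "'a::euclidean_space \<Rightarrow> real"
  assumes "continuous_on UNIV h" "AE x in lebesgue. h x \<le> C"
  shows "h x \<le> C"
proof -
  have "open {x. C < h x}" using assms(1) by (intro open_Collect_less continuous_intros)
  moreover have "{x. C < h x} \<in> null_sets lebesgue"
    using assms(2) calculation by (subst AE_iff_null_sets) (auto elim: eventually_mono)
  ultimately have "{x. C < h x} = {}" using open_not_negligible negligible_iff_null_sets by blast
  then show ?thesis by (auto simp: not_less[symmetric])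
qed

text \<open>The filter sees only the values of the field within distance \<open>l\<close>, so the global bound applied
  to the truncated field gives a local one.\<close>

lemma filtered_curl_local_bound:
  assumes \<phi>: "Cc_infty (ball 0 1) \<phi>" and l: "0 < l"
    and bound: "\<And>f. in_L2 f \<Longrightarrow> Linfnorm (curl (filter_conv \<phi> l f)) \<le> ennreal (C * l powr (-5/2) * L2norm f)"
    and C: "0 < C" and f: "in_L2 f" and x: "x \<in> ball a r" and R: "r + l \<le> R"
  shows "ennreal ((norm (curl (filter_conv \<phi> l f) x))\<^sup>2)
    \<le> ennreal (C\<^sup>2 / l ^ 5) * (\<integral>\<^sup>+y\<in>ball a R. ennreal ((norm (f y))\<^sup>2) \<partial>lebesgue)"
proof -
  define g where "g p = (1 / l ^ 3) * \<phi> (inverse l *\<^sub>R p)" for p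
  have gC: "\<forall>k. Ck k g" and gV: "vanishes_outside l g"
    unfolding g_def[abs_def] using Cc_infty_scaled[OF \<phi> l] by blast+
  have fc: "filter_conv \<phi> l = conv g" unfolding filter_conv_eq_conv g_def[abs_def] ..
  define f' where "f' y = indicator (ball a R) y *\<^sub>R f y" for y
  have [measurable]: "f \<in> borel_measurable lebesgue" using f by (simp add: in_L2_def)
  have [measurable]: "f' \<in> borel_measurable lebesgue"
    unfolding f'_def[abs_def] by (intro borel_measurable_scaleR borel_measurable_indicator) auto
  have f'sq: "(norm (f' y))\<^sup>2 = (norm (f y))\<^sup>2 * indicator (ball a R) y" for y
    by (simp add: f'_def indicator_def)
  have f'L2: "in_L2 f'"
    using f unfolding in_L2_def f'sq
    by (auto intro!: integrable_real_mult_indicator)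
  have eq: "curl (conv g f) x = curl (conv g f') x"
  proof -
    have "conv (pd j g) f x = conv (pd j g) f' x" for j
      unfolding conv_def
    proof (intro Bochner_Integration.integral_cong refl)
      fix y
      show "pd j g (x - y) *\<^sub>R f y = pd j g (x - y) *\<^sub>R f' y"
      proof (cases "y \<in> ball a R")
        case False
        have "dist a y \<le> dist a x + norm (x - y)" by (metis dist_norm dist_triangle)
        then have "l < norm (x - y)" using False x R by auto
        then show ?thesis using vanishes_outside_pd[OF gV, of j] by (simp add: vanishes_outside_def)
      qed (simp add: f'_def)
    qed
    then show ?thesis
      using curl_conv[OF in_L2_locally_integrable _ gV] gC f f'L2 by simp
  qed
  let ?K = "C * l powr (-5/2) * L2norm f'"
  have L2: "0 \<le> L2norm f'" by (simp add: L2norm_def)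
  have K: "0 \<le> ?K" using C L2 by simp
  have "AE y in lebesgue. ennreal (norm (curl (conv g f') y)) \<le> ennreal ?K"
    using esssup_AE[of "\<lambda>y. ennreal (norm (curl (conv g f') y))" lebesgue]
    by eventually_elim (use bound[OF f'L2] in \<open>auto simp: Linfnorm_def fc intro: order_trans\<close>)
  then have "AE y in lebesgue. norm (curl (conv g f') y) \<le> ?K"
    using K by simp
  moreover have "continuous_on UNIV (\<lambda>y. norm (curl (conv g f') y))"
    using Ck_mono[of 0, OF Ck_curl_conv[OF in_L2_locally_integrable[OF f'L2] gC gV, unfolded One_nat_def]]
    by (intro continuous_intros) simp
  ultimately have "norm (curl (conv g f') x) \<le> ?K" using continuous_AE_le_imp_le by blast
  then have "(norm (curl (conv g f') x))\<^sup>2 \<le> ?K\<^sup>2" by (rule power_mono) simp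
  \<comment> \<open>Squaring \<open>l powr (-5/2)\<close> gives \<open>1 / l ^ 5\<close>, the source
    of the fifth power in the final estimate.\<close>
  also have "?K\<^sup>2 = C\<^sup>2 / l ^ 5 * (L2norm f')\<^sup>2"
  proof -
    have "(l powr (-5/2))\<^sup>2 = l powr (-5)" using l by (simp add: powr_add[symmetric] power2_eq_square)
    also have "\<dots> = 1 / l ^ 5" using l powr_realpow[of l 5] by (simp add: powr_minus divide_inverse)
    finally show ?thesis by (simp add: power_mult_distrib)
  qed
  also have "(L2norm f')\<^sup>2 = (LINT y|lebesgue. (norm (f' y))\<^sup>2)"
    by (simp add: L2norm_def)
  finally have "ennreal ((norm (curl (conv g f') x))\<^sup>2) \<le> ennreal (C\<^sup>2 / l ^ 5) * ennreal (LINT y|lebesgue. (norm (f' y))\<^sup>2)"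
    using l by (subst ennreal_mult'[symmetric]) (auto intro!: ennreal_leI)
  also have "ennreal (LINT y|lebesgue. (norm (f' y))\<^sup>2) = (\<integral>\<^sup>+y. ennreal ((norm (f' y))\<^sup>2) \<partial>lebesgue)"
    using f'L2 by (subst nn_integral_eq_integral) (auto simp: in_L2_def)
  also have "\<dots> = (\<integral>\<^sup>+y\<in>ball a R. ennreal ((norm (f y))\<^sup>2) \<partial>lebesgue)"
    unfolding f'sq by (intro nn_integral_cong) (simp add: indicator_def)
  finally show ?thesis unfolding fc eq .
qed


section \<open>Integration over the space-time cylinder\<close>

lemma diff_quotient_energy_measurable:
  assumes [measurable]: "\<theta> \<in> borel_measurable borel" and F: "F \<in> borel_measurable borel"
  shows "(\<lambda>p. diff_quotient_energy \<theta> s (\<lambda>x. F (x, snd p)) (fst p)) \<in> borel_measurable (borel :: (R3 \<times> real) measure)"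
proof -
  have [measurable]: "F \<in> borel_measurable (borel \<Otimes>\<^sub>M borel)" unfolding borel_prod by (rule F)
  have "(\<lambda>p. diff_quotient_energy \<theta> s (\<lambda>x. F (x, snd p)) (fst p)) \<in> borel_measurable (borel \<Otimes>\<^sub>M borel)"
    unfolding diff_quotient_energy_def by measurable
  then show ?thesis unfolding borel_prod .
qed

text \<open>The factor \<open>1 / W\<close> cancels the mass of the kernel on each slice. Time is
  the outer variable, as in \<open>diffusion\<close>, and smoothness of every slice allows the
  spatial estimate at each \<open>t\<close>.\<close>

lemma diff_quotient_energy_cylinder_le:
  fixes F :: "R3 \<times> real \<Rightarrow> R3"
  assumes \<theta>m: "\<theta> \<in> borel_measurable borel" and Fm: "F \<in> borel_measurable borel"
    and \<theta>: "\<And>w. 0 \<le> \<theta> w" "\<And>w. w \<notin> ball 0 1 \<Longrightarrow> \<theta> w = 0"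
    and s: "0 < s" and W: "0 < W" "ennreal s * C_theta \<theta> = ennreal W"
    and F: "\<And>t. Ck 1 (\<lambda>x. F (x, t))" and I: "I \<in> sets borel"
  shows "(\<integral>\<^sup>+p. ennreal (1 / W) * diff_quotient_energy \<theta> s (\<lambda>x. F (x, snd p)) (fst p) * indicator (ball a r \<times> I) p \<partial>lborel)
    \<le> (\<integral>\<^sup>+t\<in>I. (\<integral>\<^sup>+x\<in>ball a (r + s). ennreal (grad_norm_sq (\<lambda>x. F (x, t)) x) \<partial>lborel) \<partial>lborel)"
proof -
  let ?H = "\<lambda>p. diff_quotient_energy \<theta> s (\<lambda>x. F (x, snd p)) (fst p)"
  have Hb: "?H \<in> borel_measurable borel" by (rule diff_quotient_energy_measurable[OF \<theta>m Fm])
  then have [measurable]: "?H \<in> borel_measurable (lborel \<Otimes>\<^sub>M lborel)" unfolding lborel_prod by simp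
  have "ball a r \<times> I \<in> sets (borel \<Otimes>\<^sub>M borel)" using I by auto
  then have [measurable]: "ball a r \<times> I \<in> sets (lborel \<Otimes>\<^sub>M lborel)" by simp
  have Hx: "(\<lambda>x. diff_quotient_energy \<theta> s (\<lambda>x. F (x, t)) x) \<in> borel_measurable borel" for t
  proof -
    have "(\<lambda>x :: R3. (x, t)) \<in> borel_measurable borel"
      by (intro borel_measurable_continuous_onI continuous_intros)
    from measurable_compose[OF this Hb] show ?thesis by simp
  qed
  have [measurable]: "ball a r \<in> sets borel" by simp
  have "(\<integral>\<^sup>+p. ennreal (1 / W) * ?H p * indicator (ball a r \<times> I) p \<partial>lborel)
    = (\<integral>\<^sup>+t. (\<integral>\<^sup>+x. ennreal (1 / W) * ?H (x, t) * indicator (ball a r \<times> I) (x, t) \<partial>lborel) \<partial>lborel)"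
    unfolding lborel_prod[symmetric] by (rule lborel_pair.nn_integral_snd[symmetric]) measurable
  also have "\<dots> \<le> (\<integral>\<^sup>+t\<in>I. (\<integral>\<^sup>+x\<in>ball a (r + s). ennreal (grad_norm_sq (\<lambda>x. F (x, t)) x) \<partial>lborel) \<partial>lborel)"
  proof (intro nn_integral_mono)
    fix t :: real
    let ?D = "\<integral>\<^sup>+x\<in>ball a (r + s). ennreal (grad_norm_sq (\<lambda>x. F (x, t)) x) \<partial>lborel"
    let ?h = "diff_quotient_energy \<theta> s (\<lambda>x. F (x, t))"
    show "(\<integral>\<^sup>+x. ennreal (1 / W) * ?H (x, t) * indicator (ball a r \<times> I) (x, t) \<partial>lborel) \<le> ?D * indicator I t"
    proof (cases "t \<in> I")
      case True
      have "(\<integral>\<^sup>+x. ennreal (1 / W) * ?H (x, t) * indicator (ball a r \<times> I) (x, t) \<partial>lborel)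
        = (\<integral>\<^sup>+x. ennreal (1 / W) * (?h x * indicator (ball a r) x) \<partial>lborel)"
        using True by (intro nn_integral_cong) (simp add: indicator_def)
      also have "\<dots> = ennreal (1 / W) * (\<integral>\<^sup>+x. ?h x * indicator (ball a r) x \<partial>lborel)"
        using Hx[of t] by (intro nn_integral_cmult) (auto intro!: borel_measurable_times_ennreal borel_measurable_indicator)
      also have "\<dots> \<le> ennreal (1 / W) * (ennreal s * C_theta \<theta> * ?D)"
        by (intro mult_left_mono diff_quotient_energy_integral_le \<theta>m \<theta> s F) simp_all
      also have "\<dots> = (ennreal (1 / W) * ennreal W) * ?D" unfolding W(2) by (simp only: mult.assoc)
      also have "ennreal (1 / W) * ennreal W = 1" using W(1) by (simp add: ennreal_mult'[symmetric])
      finally show ?thesis using True by simp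
    qed simp
  qed
  finally show ?thesis .
qed

section \<open>Measurability, smoothness and a.e. invariance of the filtered vorticity\<close>

lemma Omega_eq_curl_conv:
  "Omega \<phi> l u x t = curl (conv (\<lambda>p. (1 / l ^ 3) * \<phi> (inverse l *\<^sub>R p)) (\<lambda>y. u (y, t))) x"
  unfolding Omega_def filter_conv_eq_conv ..

lemma Omega_measurable:
  assumes \<phi>: "Cc_infty (ball 0 1) \<phi>" "0 < l"
    and v: "v \<in> borel_measurable borel" "\<And>t. in_L2 (\<lambda>x. v (x, t))"
  shows "(\<lambda>p. Omega \<phi> l v (fst p) (snd p)) \<in> borel_measurable borel"
proof -
  define g where "g p = (1 / l ^ 3) * \<phi> (inverse l *\<^sub>R p)" for p
  have gC: "\<forall>k. Ck k g" and gV: "vanishes_outside l g"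
    unfolding g_def[abs_def] using Cc_infty_scaled[OF \<phi>] by blast+
  have "pd j g \<in> borel_measurable borel" for j
    using Ck_pd[of 0 g j] gC by (intro borel_measurable_continuous_onI) simp
  then have m: "(\<lambda>p. conv (pd j g) (\<lambda>y. v (y, snd p)) (fst p)) \<in> borel_measurable borel" for j
    by (intro conv_measurable v)
  have c: "cross3 a \<in> borel_measurable borel" for a
    by (intro borel_measurable_continuous_onI linear_continuous_on bounded_linear_cross3)
  have "Omega \<phi> l v x t = (\<Sum>j\<in>UNIV. cross3 (axis j 1) (conv (pd j g) (\<lambda>y. v (y, t)) x))" for x t
    unfolding Omega_eq_curl_conv g_def[symmetric, abs_def]
    using curl_conv[OF in_L2_locally_integrable[OF v(2)] _ gV] gC by blast
  then show ?thesis
    by (simp only:) (intro borel_measurable_sum measurable_compose[OF m c])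
qed

lemma Ck_Omega:
  assumes "Cc_infty (ball 0 1) \<phi>" "0 < l" "in_L2 (\<lambda>x. v (x, t))"
  shows "Ck 1 (\<lambda>x. Omega \<phi> l v x t)"
  unfolding Omega_eq_curl_conv
  using Ck_curl_conv[OF in_L2_locally_integrable[OF assms(3)] Cc_infty_scaled[OF assms(1,2)]] .

lemma Omega_cong_AE:
  assumes "Cc_infty (ball 0 1) \<phi>" "0 < l" "in_L2 (\<lambda>x. u (x, t))" "in_L2 (\<lambda>x. v (x, t))"
    and "AE x in lebesgue. u (x, t) = v (x, t)"
  shows "Omega \<phi> l u x t = Omega \<phi> l v x t"
proof -
  have "continuous_on UNIV (\<lambda>p. (1 / l ^ 3) * \<phi> (inverse l *\<^sub>R p))"
    using Cc_infty_scaled(1)[OF assms(1,2), rule_format, of 0] unfolding Ck.simps(1) .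
  then have "conv (\<lambda>p. (1 / l ^ 3) * \<phi> (inverse l *\<^sub>R p)) (\<lambda>y. u (y, t))
     = conv (\<lambda>p. (1 / l ^ 3) * \<phi> (inverse l *\<^sub>R p)) (\<lambda>y. v (y, t))"
    using assms(3-) by (intro ext conv_cong_AE) (auto simp: in_L2_def)
  then show ?thesis unfolding Omega_eq_curl_conv by simp
qed

lemma Cc_infty_measurable: "Cc_infty S f \<Longrightarrow> f \<in> borel_measurable borel"
  unfolding Cc_infty_def using Ck.simps(1) borel_measurable_continuous_onI by blast

text \<open>Multiplication by \<open>r\<close> undoes the normalisation of the local energy and
  leaves the essential supremum.\<close>

lemma AE_local_energy_bound:
  assumes "0 < r"
  shows "AE t in lborel. t \<in> Itime t0 r \<longrightarrow>
    (\<integral>\<^sup>+x\<in>ball x0 ((1 + 2 * \<rho>) * r). ennreal ((norm (u (x, t)))\<^sup>2) \<partial>lebesgue)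
      \<le> ennreal r * local_energy x0 t0 r \<rho> u"
proof -
  have I: "Itime t0 r \<in> sets borel" by (simp add: Itime_def)
  define S where "S = esssup (lebesgue_on (Itime t0 r))
       (\<lambda>t. \<integral>\<^sup>+x\<in>ball x0 ((1 + 2 * \<rho>) * r). ennreal ((norm (u (x, t)))\<^sup>2) \<partial>lebesgue)"
  have "ennreal r * local_energy x0 t0 r \<rho> u = ennreal r * ennreal (1 / r) * S"
    unfolding local_energy_def S_def by (simp only: mult.assoc)
  also have "ennreal r * ennreal (1 / r) = 1" using assms by (simp add: ennreal_mult'[symmetric])
  finally have S: "ennreal r * local_energy x0 t0 r \<rho> u = S" by simp
  have "AE t in lebesgue_on (Itime t0 r). (\<integral>\<^sup>+x\<in>ball x0 ((1 + 2 * \<rho>) * r). ennreal ((norm (u (x, t)))\<^sup>2) \<partial>lebesgue) \<le> S"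
    unfolding S_def by (rule esssup_AE)
  then show ?thesis
    unfolding S using I by (subst (asm) AE_restrict_space_iff) (auto simp: AE_completion_iff)
qed

section \<open>Combining the estimates for a fixed \<open>\<eta>\<close>\<close>

theorem theorem2p2:
  fixes \<phi> \<theta> :: "R3 \<Rightarrow> real" and C\<phi> :: real
    and x0 :: "R3" and t0 r \<rho> l :: real
    and u :: "R3 \<times> real \<Rightarrow> R3" and chi :: "R3 \<times> real \<Rightarrow> real"
  assumes phi: "Cc_infty (ball 0 1) \<phi>" "\<forall>x. 0 \<le> \<phi> x" "(LINT x|lebesgue. \<phi> x) = 1"
    and C_phi: "0 < C\<phi>"
      "\<forall>s>0. \<forall>f. in_L2 f \<longrightarrow>
         Linfnorm (curl (filter_conv \<phi> s f)) \<le> ennreal (C\<phi> * s powr (-5/2) * L2norm f)"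
    and theta: "Cc_infty (ball 0 1) \<theta>" "\<forall>w w'. norm w = norm w' \<longrightarrow> \<theta> w = \<theta> w'"
      "\<forall>w. 0 \<le> \<theta> w \<and> \<theta> w \<le> 1" "\<forall>w\<in>ball 0 (1/2). \<theta> w = 1"
    and params: "0 < r" "0 < \<rho>" "\<rho> \<le> 1/4" "0 < l" "l \<le> \<rho> * r"
    and u: "in_Linf_L2 (Itime t0 r) u" "div_free (Itime t0 r) u"
    and cutoff: "Cc_infty (Qcyl x0 t0 r) chi" "\<forall>p. 0 \<le> chi p \<and> chi p \<le> 1"
  shows "\<forall>\<eta>>0.
    (let RHS = ennreal \<eta> * diffusion \<phi> x0 t0 r \<rho> l u
           + (C_theta \<theta>)\<^sup>2 * ennreal (C\<phi>\<^sup>2 * \<rho>\<^sup>2 / \<eta>) * local_energy x0 t0 r \<rho> u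
             * ennreal ((r / l) ^ 5) * enstrophy \<phi> x0 t0 r l u chi
     in pair_defect \<phi> \<theta> x0 t0 r \<rho> l u chi \<le> RHS \<and>
        (RHS < \<infinity> \<longrightarrow> pair_defect \<phi> \<theta> x0 t0 r \<rho> l u chi < \<infinity>))"
proof (intro allI impI)
  fix \<eta> :: real assume \<eta>: "0 < \<eta>"
  let ?I = "Itime t0 r" and ?Q = "Qcyl x0 t0 r"
  let ?M = "local_energy x0 t0 r \<rho> u" and ?O = "enstrophy \<phi> x0 t0 r l u chi"
  have I: "?I \<in> sets borel" by (simp add: Itime_def)
  have Q: "?Q \<in> sets borel"
    unfolding Qcyl_def Itime_def by (intro borel_open open_Times) auto
  obtain v N where vm: "v \<in> borel_measurable borel" and N: "N \<in> null_sets lborel"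
    and vL2: "\<And>t. in_L2 (\<lambda>x. v (x, t))"
    and uv: "\<And>t. t \<in> ?I - N \<Longrightarrow> in_L2 (\<lambda>x. u (x, t))"
      "\<And>t. t \<in> ?I - N \<Longrightarrow> AE x in lebesgue. u (x, t) = v (x, t)"
    by (rule Linf_L2_borel_representative[OF u(1) I]) (rule that; assumption)
  note v = vm vL2
  \<comment> \<open>\<open>F\<close> is built from the Borel representative, so it is jointly Borel
    and smooth in space at every time; it is identified with the vorticity of \<open>u\<close> only
    at times outside \<open>N\<close>.\<close>
  define F where "F p = Omega \<phi> l v (fst p) (snd p)" for p
  have Fm [measurable]: "F \<in> borel_measurable borel"
    unfolding F_def[abs_def] by (rule Omega_measurable[OF phi(1) params(4) v])
  have F1: "Ck 1 (\<lambda>x. F (x, t))" for t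
    unfolding F_def using Ck_Omega[OF phi(1) params(4) v(2)] by simp
  have uF: "Omega \<phi> l u x t = F (x, t)" if "t \<in> ?I - N" for x t
    using Omega_cong_AE[OF phi(1) params(4) uv(1)[OF that] v(2) uv(2)[OF that]] by (simp add: F_def)
  have \<theta>m: "\<theta> \<in> borel_measurable borel"
    using theta(1) Cc_infty_measurable by blast
  have chim [measurable]: "chi \<in> borel_measurable borel"
    using cutoff(1) Cc_infty_measurable by blast
  have \<theta>0: "0 \<le> \<theta> w" for w using theta(3) by simp
  have \<theta>out: "\<theta> w = 0" if "w \<notin> ball 0 1" for w
    using that theta(1) closure_subset[of "{x. \<theta> x \<noteq> 0}"] unfolding Cc_infty_def by blast
  have s: "0 < \<rho> * r" using params by simp
  \<comment> \<open>A bound for the squared vorticity on the cylinder: the filter constant times the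
    unnormalised local energy.\<close>
  define K where "K = ennreal (C\<phi>\<^sup>2 / l ^ 5) * (ennreal r * ?M)"
  have "AE t in lborel. t \<notin> N" using N by (rule AE_not_in)
  with AE_local_energy_bound[OF params(1), where ?t0.0 = t0 and ?x0.0 = x0 and \<rho> = \<rho> and u = u]
  have AEt: "AE t in lborel. t \<in> ?I \<longrightarrow> (\<forall>x. Omega \<phi> l u x t = F (x, t))
      \<and> (\<forall>x\<in>ball x0 r. ennreal ((norm (F (x, t)))\<^sup>2) \<le> K)"
  proof eventually_elim
    case (elim t)
    show ?case
    proof (intro impI conjI ballI allI)
      assume t: "t \<in> ?I"
      then show uFt: "Omega \<phi> l u x t = F (x, t)" for x using uF elim by blast
      fix x assume x: "x \<in> ball x0 r"
      have "ennreal ((norm (curl (filter_conv \<phi> l (\<lambda>y. u (y, t))) x))\<^sup>2)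
        \<le> ennreal (C\<phi>\<^sup>2 / l ^ 5) * (\<integral>\<^sup>+y\<in>ball x0 ((1 + 2 * \<rho>) * r). ennreal ((norm (u (y, t)))\<^sup>2) \<partial>lebesgue)"
      proof (rule filtered_curl_local_bound[OF phi(1) params(4) _ C_phi(1) _ x])
        show "Linfnorm (curl (filter_conv \<phi> l f)) \<le> ennreal (C\<phi> * l powr (-5/2) * L2norm f)" if "in_L2 f" for f
          using C_phi(2) params(4) that by blast
        show "in_L2 (\<lambda>y. u (y, t))" using uv(1) t elim by blast
        \<comment> \<open>Since \<open>l\<close> is at most \<open>\<rho> * r\<close>, the filter
          reaches no further than the ball used in the local energy.\<close>
        show "r + l \<le> (1 + 2 * \<rho>) * r" using params s by (simp add: algebra_simps)
      qed
      also have "\<dots> \<le> K" unfolding K_def using elim t by (intro mult_left_mono) auto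
      finally show "ennreal ((norm (F (x, t)))\<^sup>2) \<le> K" using uFt[of x] by (simp add: Omega_def)
    qed
  qed
  have AEp: "AE p in lborel. p \<in> ?Q \<longrightarrow> (\<forall>x. Omega \<phi> l u x (snd p) = F (x, snd p)) \<and> ennreal ((norm (F p))\<^sup>2) \<le> K"
    using AE_snd[OF AEt] by eventually_elim (auto simp: Qcyl_def)
  define c where "c p = chi p * (norm (F p))\<^sup>2" for p
  have c0: "0 \<le> c p" for p using cutoff(2)[rule_format, of p] by (simp add: c_def)
  have cm [measurable]: "c \<in> borel_measurable borel" unfolding c_def[abs_def] by measurable
  let ?inner = "\<lambda>p. pair_inner \<phi> \<theta> r \<rho> l u (fst p) (snd p)"
  define J where "J = (\<integral>\<^sup>+p\<in>?Q. ennreal (c p) \<partial>lborel)"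
  have O: "?O = ennreal (1 / r) * J"
    unfolding enstrophy_def J_def nn_integral_completion
    using AEp by (intro arg_cong2[where f = "(*)"] refl nn_integral_cong_AE, eventually_elim)
      (auto simp: c_def indicator_def)
  have "ennreal r * ?O = ennreal r * ennreal (1 / r) * J" unfolding O by (simp only: mult.assoc)
  also have "ennreal r * ennreal (1 / r) = 1" using params(1) by (simp add: ennreal_mult'[symmetric])
  finally have J: "J = ennreal r * ?O" by simp
  have A: "pair_defect \<phi> \<theta> x0 t0 r \<rho> l u chi = ennreal r * (\<integral>\<^sup>+p\<in>?Q. ennreal (c p) * ?inner p \<partial>lborel)"
    unfolding pair_defect_def nn_integral_completion
    using AEp by (intro arg_cong2[where f = "(*)"] refl nn_integral_cong_AE, eventually_elim)
      (auto simp: c_def indicator_def)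
  define D where "D = (\<integral>\<^sup>+t\<in>?I. (\<integral>\<^sup>+x\<in>ball x0 (r + \<rho> * r). ennreal (grad_norm_sq (\<lambda>x. F (x, t)) x) \<partial>lborel) \<partial>lborel)"
  have P: "diffusion \<phi> x0 t0 r \<rho> l u = ennreal r * D"
  proof -
    have R: "(1 + \<rho>) * r = r + \<rho> * r" by (simp add: algebra_simps)
    show ?thesis unfolding diffusion_def D_def nn_integral_completion R
      using AEt by (intro arg_cong2[where f = "(*)"] refl nn_integral_cong_AE, eventually_elim)
        (auto simp: indicator_def)
  qed
  let ?T = "(C_theta \<theta>)\<^sup>2 * ennreal (C\<phi>\<^sup>2 * \<rho>\<^sup>2 / \<eta>) * ?M * ennreal ((r / l) ^ 5) * ?O"
  let ?A = "pair_defect \<phi> \<theta> x0 t0 r \<rho> l u chi"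
  have "?A \<le> ennreal \<eta> * diffusion \<phi> x0 t0 r \<rho> l u + ?T"
  proof (cases "C_theta \<theta> = \<infinity>")
    case True
    \<comment> \<open>The right-hand side is infinite unless the weight \<open>c\<close> vanishes almost everywhere, so the
      integrability of the kernel need not be established.\<close>
    show ?thesis
    proof (cases "?M = 0 \<or> ?O = 0")
      case True
      \<comment> \<open>Zero local energy forces \<open>K = 0\<close>, hence \<open>F = 0\<close>
        almost everywhere on the cylinder; zero enstrophy forces the integral of \<open>c\<close> to
        vanish. In these cases the product with the infinite constant is zero, so the defect itself
        must be shown to vanish.\<close>
      have "AE p in lborel. p \<in> ?Q \<longrightarrow> c p = 0"
      proof (cases "?M = 0")
        case True
        then have "K = 0" by (simp add: K_def)
        show ?thesis
          using AEp by eventually_elim (auto simp: \<open>K = 0\<close> c_def ennreal_eq_0_iff)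
      next
        case False
        with True J have "J = 0" by simp
        then have "AE p in lborel. ennreal (c p) * indicator ?Q p = 0"
          unfolding J_def using Q by (subst (asm) nn_integral_0_iff_AE) auto
        then show ?thesis by eventually_elim (use c0 in \<open>auto simp: ennreal_eq_0_iff intro: antisym\<close>)
      qed
      then have "AE p in lborel. ennreal (c p) * ?inner p * indicator ?Q p = 0"
        by eventually_elim (auto simp: indicator_def)
      from nn_integral_cong_AE[OF this]
      have "(\<integral>\<^sup>+p\<in>?Q. ennreal (c p) * ?inner p \<partial>lborel) = 0" by simp
      then show ?thesis unfolding A by simp
    next
      case False
      have "0 < C\<phi>\<^sup>2 * \<rho>\<^sup>2 / \<eta>" "0 < (r / l) ^ 5" using C_phi(1) params \<eta> by simp_all
      then have "?T = \<infinity>"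
        using True False by (simp add: ennreal_mult_eq_top_iff power2_eq_square ennreal_eq_0_iff not_le)
      then show ?thesis by simp
    qed
  next
    case False
    then obtain C where C: "0 \<le> C" "C_theta \<theta> = ennreal C"
      by (cases "C_theta \<theta>") auto
    have "0 < C" using C_theta_pos[OF \<theta>m theta(4)] C by simp
    define W where "W = \<rho> * r * C"
    have W: "0 < W" "ennreal (\<rho> * r) * C_theta \<theta> = ennreal W"
      using s \<open>0 < C\<close> unfolding W_def C(2) by (simp_all add: ennreal_mult)
    define H where "H p = diff_quotient_energy \<theta> (\<rho> * r) (\<lambda>x. F (x, snd p)) (fst p)" for p
    have Hm [measurable]: "H \<in> borel_measurable borel"
      unfolding H_def[abs_def] by (rule diff_quotient_energy_measurable[OF \<theta>m Fm])
    have slice_m: "(\<lambda>x. F (x, t)) \<in> borel_measurable borel" for t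
      using Ck_mono[OF F1[of t, unfolded One_nat_def]] unfolding Ck.simps(1)
      by (rule borel_measurable_continuous_onI)
    have "(\<integral>\<^sup>+p\<in>?Q. ennreal (c p) * ?inner p \<partial>lborel)
      \<le> (\<integral>\<^sup>+p. ennreal \<eta> * (ennreal (1 / W) * H p * indicator ?Q p)
            + ennreal (W\<^sup>2 / \<eta>) * K * (ennreal (c p) * indicator ?Q p) \<partial>lborel)"
    \<comment> \<open>The left side is treated by monotonicity alone; the integral of the Borel
      majorant is the one that is split and iterated.\<close>
    proof (intro nn_integral_mono_AE)
      show "AE p in lborel. ennreal (c p) * ?inner p * indicator ?Q p
        \<le> ennreal \<eta> * (ennreal (1 / W) * H p * indicator ?Q p) + ennreal (W\<^sup>2 / \<eta>) * K * (ennreal (c p) * indicator ?Q p)"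
        using AEp
      proof eventually_elim
        case (elim p)
        show ?case
        proof (cases "p \<in> ?Q")
          case True
          with elim have eq: "\<And>y. Omega \<phi> l u y (snd p) = F (y, snd p)" and le: "ennreal ((norm (F p))\<^sup>2) \<le> K"
            by auto
          \<comment> \<open>Here \<open>\<alpha> = \<eta> / W\<close>.\<close>
          have "ennreal (c p) * ?inner p \<le> ennreal (\<eta> / W) * H p
              + ennreal ((c p)\<^sup>2 / (\<eta> / W)) * (ennreal (\<rho> * r) * C_theta \<theta>)"
            unfolding H_def using \<eta> W(1) c0
            by (intro pair_inner_bound \<theta>m slice_m \<theta>0 \<theta>out s eq) (auto simp: c_def)
          also have "ennreal (\<eta> / W) = ennreal \<eta> * ennreal (1 / W)"
            using \<eta> W(1) by (simp add: ennreal_mult'[symmetric])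
          also have "ennreal ((c p)\<^sup>2 / (\<eta> / W)) * (ennreal (\<rho> * r) * C_theta \<theta>) = ennreal (W\<^sup>2 / \<eta>) * ennreal ((c p)\<^sup>2)"
            unfolding W(2) using \<eta> W(1) by (simp add: ennreal_mult'[symmetric] power2_eq_square mult_ac)
          \<comment> \<open>Only one factor \<open>c\<close> is spent on the supremum bound, using
            that \<open>chi\<close> is at most 1; the other is kept to become the enstrophy.\<close>
          also have "ennreal ((c p)\<^sup>2) \<le> K * ennreal (c p)"
          proof -
            have "(c p)\<^sup>2 = chi p * ((norm (F p))\<^sup>2 * c p)" by (simp add: c_def power2_eq_square)
            also have "\<dots> \<le> 1 * ((norm (F p))\<^sup>2 * c p)"
              using cutoff(2)[rule_format, of p] c0 by (intro mult_right_mono) auto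
            finally have "ennreal ((c p)\<^sup>2) \<le> ennreal ((norm (F p))\<^sup>2) * ennreal (c p)"
              using c0 by (simp add: ennreal_mult'[symmetric] ennreal_leI)
            also have "\<dots> \<le> K * ennreal (c p)" by (intro mult_right_mono le) simp
            finally show ?thesis .
          qed
          finally have "ennreal (c p) * ?inner p \<le> ennreal \<eta> * ennreal (1 / W) * H p + ennreal (W\<^sup>2 / \<eta>) * (K * ennreal (c p))"
            by (simp add: add_left_mono mult_left_mono)
          then show ?thesis using True by (simp add: mult.assoc)
        qed simp
      qed
    qed
    also have "\<dots> = ennreal \<eta> * (\<integral>\<^sup>+p. ennreal (1 / W) * H p * indicator ?Q p \<partial>lborel) + ennreal (W\<^sup>2 / \<eta>) * K * J"
      unfolding J_def using Q
      by (subst nn_integral_add; (subst nn_integral_cmult)?; (subst nn_integral_cmult)?; measurable?)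
    also have "(\<integral>\<^sup>+p. ennreal (1 / W) * H p * indicator ?Q p \<partial>lborel) \<le> D"
      unfolding H_def D_def Qcyl_def
      by (rule diff_quotient_energy_cylinder_le[OF \<theta>m Fm \<theta>0 \<theta>out s W F1 I])
    finally have "(\<integral>\<^sup>+p\<in>?Q. ennreal (c p) * ?inner p \<partial>lborel) \<le> ennreal \<eta> * D + ennreal (W\<^sup>2 / \<eta>) * K * J"
      by (simp add: add_right_mono mult_left_mono)
    then have "?A \<le> ennreal r * (ennreal \<eta> * D + ennreal (W\<^sup>2 / \<eta>) * K * J)"
      unfolding A by (rule mult_left_mono) simp
    also have "\<dots> = ennreal \<eta> * diffusion \<phi> x0 t0 r \<rho> l u
        + (ennreal r * ennreal (W\<^sup>2 / \<eta>) * ennreal (C\<phi>\<^sup>2 / l ^ 5) * ennreal r * ennreal r) * ?M * ?O"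
      unfolding P J K_def by (simp only: distrib_left mult_ac)
    also have "ennreal r * ennreal (W\<^sup>2 / \<eta>) * ennreal (C\<phi>\<^sup>2 / l ^ 5) * ennreal r * ennreal r
        = ennreal (r * (W\<^sup>2 / \<eta>) * (C\<phi>\<^sup>2 / l ^ 5) * r * r)"
      using params(1,4) \<eta> by (simp only: ennreal_mult[symmetric] zero_le_mult_iff zero_le_divide_iff zero_le_power2 zero_le_power less_imp_le simp_thms mult_nonneg_nonneg divide_nonneg_nonneg)
    \<comment> \<open>The three factors \<open>r\<close> come from the prefactor of the defect, from
      \<open>K\<close> and from \<open>J\<close>; with the \<open>r^2\<close> inside
      \<open>W^2\<close> they make up the fifth power that pairs with \<open>l ^ 5\<close>.\<close>
    also have "r * (W\<^sup>2 / \<eta>) * (C\<phi>\<^sup>2 / l ^ 5) * r * r = C\<^sup>2 * (C\<phi>\<^sup>2 * \<rho>\<^sup>2 / \<eta>) * (r / l) ^ 5"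
      using params(4) \<eta> by (simp add: W_def field_simps power_divide power2_eq_square eval_nat_numeral)
    also have "ennreal (C\<^sup>2 * (C\<phi>\<^sup>2 * \<rho>\<^sup>2 / \<eta>) * (r / l) ^ 5)
        = (C_theta \<theta>)\<^sup>2 * ennreal (C\<phi>\<^sup>2 * \<rho>\<^sup>2 / \<eta>) * ennreal ((r / l) ^ 5)"
    proof -
      have mult3: "ennreal (a * b * d) = ennreal a * ennreal b * ennreal d" if "0 \<le> a" "0 \<le> b" "0 \<le> d" for a b d
        using that by (simp add: ennreal_mult)
      have "(C_theta \<theta>)\<^sup>2 = ennreal (C\<^sup>2)" using C by (simp add: ennreal_power)
      moreover have "0 \<le> C\<phi>\<^sup>2 * \<rho>\<^sup>2 / \<eta>" "0 \<le> (r / l) ^ 5" using params \<eta> by simp_all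
      ultimately show ?thesis using mult3 by (simp only: zero_le_power2)
    qed
    also have "\<dots> * ?M * ?O = ?T" by (simp only: mult_ac)
    finally show ?thesis .
  qed
  then show "let RHS = ennreal \<eta> * diffusion \<phi> x0 t0 r \<rho> l u + ?T
     in ?A \<le> RHS \<and> (RHS < \<infinity> \<longrightarrow> ?A < \<infinity>)"
    unfolding Let_def by (auto intro: le_less_trans)
qed

end
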